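(* Let $(M,g,\omega)$ be a K\"ahler-Einstein surface (complex dimension two). Let $\lambda_1\le\lambda_2\le\lambda_3$ be the eigenvalues (at each point) of $W^{-}$, and let $H_{max}$ (resp. $H_{min}$) be the maximum (resp. minimum) of the holomorphic sectional curvature at each point. Then \[H_{max}=\frac{s}{6}+\frac{\lambda_3}{2},\qquad H_{min}=\frac{s}{6}+\frac{\lambda_1}{2},\] where $s$ is the scalar curvature.
   Context: $M$ carries the orientation induced by the complex structure $J$. The curvature operator on 2-forms (with sign such that $\langle\mathfrak R(X\wedge Y),X\wedge Y\rangle$ is the sectional curvature for orthonormal $X,Y$) has diagonal blocks $W^{+}+\frac{s}{12}I$ on self-dual forms $\Lambda^+$ and $W^{-}+\frac{s}{12}I$ on anti-self-dual forms $\Lambda^-$, with $W^\pm$ trace-free. For a unit tangent vector $X$, the holomorphic sectional curvature $H(X)$ is the sectional curvature of the plane spanned by $X$ and $JX$; the maximum and minimum at $p$ are over all unit vectors in $T_pM$. *)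

theory Defs
  imports "HOL-Analysis.Analysis"
begin

section \<open>Local Riemannian geometry in four real coordinates\<close>

definition pd :: "4 \<Rightarrow> (real^4 \<Rightarrow> real) \<Rightarrow> real^4 \<Rightarrow> real" where
  "pd i f x = frechet_derivative f (at x) (axis i 1)"

primrec Ck_on :: "nat \<Rightarrow> (real^4) set \<Rightarrow> (real^4 \<Rightarrow> real) \<Rightarrow> bool" where
  "Ck_on 0 S f \<longleftrightarrow> continuous_on S f"
| "Ck_on (Suc k) S f \<longleftrightarrow> (\<forall>x\<in>S. f differentiable (at x)) \<and> (\<forall>i. Ck_on k S (pd i f))"

definition smooth_on :: "(real^4) set \<Rightarrow> (real^4 \<Rightarrow> real) \<Rightarrow> bool" where
  "smooth_on S f \<longleftrightarrow> (\<forall>k. Ck_on k S f)"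

text \<open>A Riemannian metric in a chart is its matrix-valued coordinate expression
  \<^term>\<open>G :: real^4 \<Rightarrow> real^4^4\<close>; tangent vectors at a point are given by their
  components in the coordinate frame.\<close>

definition ip :: "(real^4 \<Rightarrow> real^4^4) \<Rightarrow> real^4 \<Rightarrow> real^4 \<Rightarrow> real^4 \<Rightarrow> real" where
  "ip G x u v = u \<bullet> (G x *v v)"

definition christoffel :: "(real^4 \<Rightarrow> real^4^4) \<Rightarrow> 4 \<Rightarrow> 4 \<Rightarrow> 4 \<Rightarrow> real^4 \<Rightarrow> real" where
  "christoffel G k i j x =
     (1/2) * (\<Sum>l\<in>UNIV. matrix_inv (G x) $ k $ l *
        (pd i (\<lambda>y. G y $ j $ l) x + pd j (\<lambda>y. G y $ i $ l) x - pd l (\<lambda>y. G y $ i $ j) x))"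

text \<open>The component along the \<open>l\<close>-th coordinate field of
  \<open>R(\<partial>\<^sub>i, \<partial>\<^sub>j) \<partial>\<^sub>k = \<nabla>\<^sub>i \<nabla>\<^sub>j \<partial>\<^sub>k - \<nabla>\<^sub>j \<nabla>\<^sub>i \<partial>\<^sub>k\<close>
  for the Levi-Civita connection.\<close>

definition curv_comp :: "(real^4 \<Rightarrow> real^4^4) \<Rightarrow> 4 \<Rightarrow> 4 \<Rightarrow> 4 \<Rightarrow> 4 \<Rightarrow> real^4 \<Rightarrow> real" where
  "curv_comp G l i j k x =
     pd i (christoffel G l j k) x - pd j (christoffel G l i k) x
     + (\<Sum>m\<in>UNIV. christoffel G m j k x * christoffel G l i m x
                 - christoffel G m i k x * christoffel G l j m x)"

definition curv :: "(real^4 \<Rightarrow> real^4^4) \<Rightarrow> real^4 \<Rightarrow> real^4 \<Rightarrow> real^4 \<Rightarrow> real^4 \<Rightarrow> real^4" where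
  "curv G x u v w =
     (\<chi> l. \<Sum>i\<in>UNIV. \<Sum>j\<in>UNIV. \<Sum>k\<in>UNIV. u $ i * v $ j * w $ k * curv_comp G l i j k x)"

definition riem :: "(real^4 \<Rightarrow> real^4^4) \<Rightarrow> real^4 \<Rightarrow> real^4 \<Rightarrow> real^4 \<Rightarrow> real^4 \<Rightarrow> real^4 \<Rightarrow> real" where
  "riem G x u v w z = ip G x (curv G x u v w) z"

definition sectional :: "(real^4 \<Rightarrow> real^4^4) \<Rightarrow> real^4 \<Rightarrow> real^4 \<Rightarrow> real^4 \<Rightarrow> real" where
  "sectional G x u v =
     riem G x u v v u / (ip G x u u * ip G x v v - (ip G x u v)\<^sup>2)"

definition ricci :: "(real^4 \<Rightarrow> real^4^4) \<Rightarrow> real^4 \<Rightarrow> real^4 \<Rightarrow> real^4 \<Rightarrow> real" where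
  "ricci G x v w = (\<Sum>l\<in>UNIV. curv G x (axis l 1) v w $ l)"

definition scalar_curv :: "(real^4 \<Rightarrow> real^4^4) \<Rightarrow> real^4 \<Rightarrow> real" where
  "scalar_curv G x =
     (\<Sum>i\<in>UNIV. \<Sum>j\<in>UNIV. matrix_inv (G x) $ i $ j * ricci G x (axis i 1) (axis j 1))"

text \<open>Kulkarni-Nomizu product of two symmetric bilinear forms, with the argument order and
  sign for which a metric \<open>g\<close> of constant sectional curvature \<open>c\<close> has
  \<^const>\<open>riem\<close> equal to \<open>(c/2)\<close> times the product of \<open>g\<close> with itself.\<close>

definition kn_prod ::
  "(real^4 \<Rightarrow> real^4 \<Rightarrow> real) \<Rightarrow> (real^4 \<Rightarrow> real^4 \<Rightarrow> real) \<Rightarrow>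
   real^4 \<Rightarrow> real^4 \<Rightarrow> real^4 \<Rightarrow> real^4 \<Rightarrow> real" where
  "kn_prod a b u v w z = a v w * b u z + b v w * a u z - a u w * b v z - b u w * a v z"

text \<open>The Weyl tensor. In dimension \<open>n\<close> the coefficients are \<open>1/(n-2)\<close> and
  \<open>s/(2(n-1)(n-2))\<close>; here \<open>n = 4\<close>.\<close>

definition weyl :: "(real^4 \<Rightarrow> real^4^4) \<Rightarrow> real^4 \<Rightarrow> real^4 \<Rightarrow> real^4 \<Rightarrow> real^4 \<Rightarrow> real^4 \<Rightarrow> real" where
  "weyl G x u v w z =
     riem G x u v w z - (1/2) * kn_prod (ricci G x) (ip G x) u v w z
     + (scalar_curv G x / 12) * kn_prod (ip G x) (ip G x) u v w z"


section \<open>Two-forms and the anti-self-dual part of the Weyl operator\<close>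

text \<open>A two-form at a point is the skew matrix of its covariant components.\<close>

definition two_forms :: "(real^4^4) set" where
  "two_forms = {\<Phi>. transpose \<Phi> = - \<Phi>}"

definition raise2 :: "(real^4 \<Rightarrow> real^4^4) \<Rightarrow> real^4 \<Rightarrow> real^4^4 \<Rightarrow> real^4^4" where
  "raise2 G x \<Phi> = matrix_inv (G x) ** \<Phi> ** transpose (matrix_inv (G x))"

text \<open>The Riemannian volume form for the standard orientation of \<^typ>\<open>real^4\<close>.\<close>

definition vol :: "(real^4 \<Rightarrow> real^4^4) \<Rightarrow> real^4 \<Rightarrow> real^4 \<Rightarrow> real^4 \<Rightarrow> real^4 \<Rightarrow> real^4 \<Rightarrow> real" where
  "vol G x u v w z = sqrt (det (G x)) * det (vector [u, v, w, z] :: real^4^4)"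

definition hodge :: "(real^4 \<Rightarrow> real^4^4) \<Rightarrow> real^4 \<Rightarrow> real^4^4 \<Rightarrow> real^4^4" where
  "hodge G x \<Phi> = (\<chi> i j. (1/2) * (\<Sum>k\<in>UNIV. \<Sum>l\<in>UNIV.
     raise2 G x \<Phi> $ k $ l * vol G x (axis k 1) (axis l 1) (axis i 1) (axis j 1)))"

definition asd_forms :: "(real^4 \<Rightarrow> real^4^4) \<Rightarrow> real^4 \<Rightarrow> (real^4^4) set" where
  "asd_forms G x = {\<Phi> \<in> two_forms. hodge G x \<Phi> = - \<Phi>}"

text \<open>The operator on two-forms induced by a (0,4)-tensor \<open>T\<close> with the symmetries of a
  curvature tensor. The indices \<open>j, i\<close> come in reversed order so that, identifying vectors with
  covectors by the metric and normalising by \<open>|e\<^sub>1 \<and> e\<^sub>2| = 1\<close> for orthonormal vectors, one has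
  \<open>\<langle>T(X \<and> Y), Z \<and> V\<rangle> = T(X, Y, V, Z)\<close>. For \<open>T\<close> the Riemann tensor this is the curvature
  operator whose value \<open>\<langle>T(X \<and> Y), X \<and> Y\<rangle>\<close> is the sectional curvature.\<close>

definition form_operator ::
  "(real^4 \<Rightarrow> real^4^4) \<Rightarrow> real^4 \<Rightarrow> (real^4 \<Rightarrow> real^4 \<Rightarrow> real^4 \<Rightarrow> real^4 \<Rightarrow> real) \<Rightarrow>
   real^4^4 \<Rightarrow> real^4^4" where
  "form_operator G x T \<Phi> = (\<chi> i j. (1/2) * (\<Sum>k\<in>UNIV. \<Sum>l\<in>UNIV.
     raise2 G x \<Phi> $ k $ l * T (axis k 1) (axis l 1) (axis j 1) (axis i 1)))"

definition weyl_operator :: "(real^4 \<Rightarrow> real^4^4) \<Rightarrow> real^4 \<Rightarrow> real^4^4 \<Rightarrow> real^4^4" where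
  "weyl_operator G x = form_operator G x (weyl G x)"

text \<open>The list \<open>es\<close> consists of the eigenvalues of \<open>T\<close> restricted to the subspace \<open>V\<close>, each repeated
  according to the dimension of its eigenspace. \<open>W\<^sup>-\<close> is the restriction of the Weyl operator
  to the anti-self-dual forms; it is self-adjoint, so geometric and algebraic multiplicities agree.\<close>

definition eigenvalues_on ::
  "'a::real_vector set \<Rightarrow> ('a \<Rightarrow> 'a) \<Rightarrow> real list \<Rightarrow> bool" where
  "eigenvalues_on V T es \<longleftrightarrow> (\<forall>\<mu>. count_list es \<mu> = dim {v \<in> V. T v = \<mu> *\<^sub>R v})"

definition weyl_minus_eigenvalues ::
  "(real^4 \<Rightarrow> real^4^4) \<Rightarrow> real^4 \<Rightarrow> real list \<Rightarrow> bool" where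
  "weyl_minus_eigenvalues G x es \<longleftrightarrow> eigenvalues_on (asd_forms G x) (weyl_operator G x) es"


section \<open>Complex surfaces and Kaehler-Einstein metrics\<close>

text \<open>The space \<open>\<complex>\<^sup>2\<close> is modelled on \<^typ>\<open>real^4\<close> with coordinates
  \<open>(Re z\<^sub>1, Im z\<^sub>1, Re z\<^sub>2, Im z\<^sub>2)\<close>, and \<open>J0\<close> is multiplication by the imaginary unit. The
  standard orientation of \<^typ>\<open>real^4\<close> is the one induced by \<open>J0\<close>: frames
  \<open>(u, J0 u, v, J0 v)\<close> are positive.\<close>

definition J0 :: "real^4 \<Rightarrow> real^4" where
  "J0 v = vector [- (v $ 2), v $ 1, - (v $ 4), v $ 3]"

definition holomorphic2_on :: "(real^4) set \<Rightarrow> (real^4 \<Rightarrow> real^4) \<Rightarrow> bool" where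
  "holomorphic2_on S f \<longleftrightarrow>
     (\<forall>x\<in>S. \<exists>D. (f has_derivative D) (at x) \<and> (\<forall>v. D (J0 v) = J0 (D v)))"

text \<open>A chart is a pair of its domain and its coordinate map.\<close>

type_synonym 'm chart = "'m set \<times> ('m \<Rightarrow> real^4)"

definition is_chart :: "'m topology \<Rightarrow> 'm chart \<Rightarrow> bool" where
  "is_chart M c \<longleftrightarrow> openin M (fst c) \<and> open (snd c ` fst c) \<and>
     homeomorphic_map (subtopology M (fst c)) (top_of_set (snd c ` fst c)) (snd c)"

definition transition :: "'m chart \<Rightarrow> 'm chart \<Rightarrow> real^4 \<Rightarrow> real^4" where
  "transition c d = snd d \<circ> inv_into (fst c) (snd c)"

definition overlap :: "'m chart \<Rightarrow> 'm chart \<Rightarrow> (real^4) set" where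
  "overlap c d = snd c ` (fst c \<inter> fst d)"

definition complex_surface :: "'m topology \<Rightarrow> 'm chart set \<Rightarrow> bool" where
  "complex_surface M A \<longleftrightarrow>
     Hausdorff_space M \<and> second_countable M \<and>
     (\<forall>c\<in>A. is_chart M c) \<and> (\<Union>c\<in>A. fst c) = topspace M \<and>
     (\<forall>c\<in>A. \<forall>d\<in>A. holomorphic2_on (overlap c d) (transition c d))"

text \<open>A metric assigns to each chart of the atlas its coordinate expression. The last conjunct is
  the transformation law of a covariant 2-tensor.\<close>

definition riemannian_metric ::
  "'m chart set \<Rightarrow> ('m chart \<Rightarrow> real^4 \<Rightarrow> real^4^4) \<Rightarrow> bool" where
  "riemannian_metric A g \<longleftrightarrow>
     (\<forall>c\<in>A. (\<forall>i j. smooth_on (snd c ` fst c) (\<lambda>x. g c x $ i $ j)) \<and>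
        (\<forall>x\<in>snd c ` fst c. transpose (g c x) = g c x \<and> (\<forall>v. v \<noteq> 0 \<longrightarrow> ip (g c) x v v > 0))) \<and>
     (\<forall>c\<in>A. \<forall>d\<in>A. \<forall>x\<in>overlap c d. \<forall>u v.
        ip (g c) x u v =
        ip (g d) (transition c d x) (frechet_derivative (transition c d) (at x) u)
                                    (frechet_derivative (transition c d) (at x) v))"

definition hermitian_metric ::
  "'m chart set \<Rightarrow> ('m chart \<Rightarrow> real^4 \<Rightarrow> real^4^4) \<Rightarrow> bool" where
  "hermitian_metric A g \<longleftrightarrow> riemannian_metric A g \<and>
     (\<forall>c\<in>A. \<forall>x\<in>snd c ` fst c. \<forall>u v. ip (g c) x (J0 u) (J0 v) = ip (g c) x u v)"

definition kaehler_form :: "(real^4 \<Rightarrow> real^4^4) \<Rightarrow> real^4 \<Rightarrow> real^4 \<Rightarrow> real^4 \<Rightarrow> real" where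
  "kaehler_form G x u v = ip G x (J0 u) v"

definition closed_2form_on :: "(real^4) set \<Rightarrow> (real^4 \<Rightarrow> real^4 \<Rightarrow> real^4 \<Rightarrow> real) \<Rightarrow> bool" where
  "closed_2form_on S \<omega> \<longleftrightarrow> (\<forall>x\<in>S. \<forall>i j k.
     pd i (\<lambda>y. \<omega> y (axis j 1) (axis k 1)) x
     + pd j (\<lambda>y. \<omega> y (axis k 1) (axis i 1)) x
     + pd k (\<lambda>y. \<omega> y (axis i 1) (axis j 1)) x = 0)"

definition kaehler_surface ::
  "'m topology \<Rightarrow> 'm chart set \<Rightarrow> ('m chart \<Rightarrow> real^4 \<Rightarrow> real^4^4) \<Rightarrow> bool" where
  "kaehler_surface M A g \<longleftrightarrow> complex_surface M A \<and> hermitian_metric A g \<and>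
     (\<forall>c\<in>A. closed_2form_on (snd c ` fst c) (kaehler_form (g c)))"

definition einstein_metric :: "'m chart set \<Rightarrow> ('m chart \<Rightarrow> real^4 \<Rightarrow> real^4^4) \<Rightarrow> bool" where
  "einstein_metric A g \<longleftrightarrow>
     (\<exists>\<kappa>::real. \<forall>c\<in>A. \<forall>x\<in>snd c ` fst c. \<forall>u v. ricci (g c) x u v = \<kappa> * ip (g c) x u v)"

definition kaehler_einstein_surface ::
  "'m topology \<Rightarrow> 'm chart set \<Rightarrow> ('m chart \<Rightarrow> real^4 \<Rightarrow> real^4^4) \<Rightarrow> bool" where
  "kaehler_einstein_surface M A g \<longleftrightarrow> kaehler_surface M A g \<and> einstein_metric A g"

definition hol_sectional :: "(real^4 \<Rightarrow> real^4^4) \<Rightarrow> real^4 \<Rightarrow> real^4 \<Rightarrow> real" where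
  "hol_sectional G x X = sectional G x X (J0 X)"

definition hol_sectional_values :: "(real^4 \<Rightarrow> real^4^4) \<Rightarrow> real^4 \<Rightarrow> real set" where
  "hol_sectional_values G x = {hol_sectional G x X | X. ip G x X X = 1}"

definition is_maximum :: "real set \<Rightarrow> real \<Rightarrow> bool" where
  "is_maximum S m \<longleftrightarrow> m \<in> S \<and> (\<forall>h\<in>S. h \<le> m)"

definition is_minimum :: "real set \<Rightarrow> real \<Rightarrow> bool" where
  "is_minimum S m \<longleftrightarrow> m \<in> S \<and> (\<forall>h\<in>S. m \<le> h)"

end

theory Submission
  imports Defs
begin

text \<open>Let \<open>X\<close> be a unit vector. The self-dual part of \<open>X \<and> J X\<close> is half the Kaehler form \<open>\<omega>\<close>, and its
  anti-self-dual part is \<open>\<eta>/2\<close>, where \<open>\<eta>\<close> has the norm of \<open>\<omega>\<close>. Every such \<open>\<eta>\<close> arises in this way, because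
  \<open>X \<mapsto> \<eta>\<close> is the Hopf map. The Einstein condition makes \<open>\<omega>\<close> and \<open>\<eta>\<close> orthogonal for the curvature
  operator, and the Kaehler symmetries fix the contribution of \<open>\<omega>\<close>. Hence the holomorphic sectional
  curvature of \<open>X\<close> is \<open>s/6\<close> plus half the Rayleigh quotient of \<open>W\<^sup>-\<close> at \<open>\<eta>\<close>, whose extrema are
  the extreme eigenvalues of \<open>W\<^sup>-\<close>.\<close>

section \<open>Symmetry of second derivatives\<close>

text \<open>The constant: \<open>X \<and> J X\<close> has norm 1, so each of its two parts carries
  weight 1/2. The curvature operator has Rayleigh quotient s/4 = \<kappa> at \<omega>, and on the
  anti-self-dual forms it is W^- + s/12, so the total is (s/4 + s/12)/2 = s/6 plus half the quotient
  of W^-. The obstacle is that curvature is given only by derivatives of Christoffel symbols. Its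
  symmetries are obtained by differentiating bilinear identities for the metric, with Schwarz's
  theorem for the second derivatives. Charts are holomorphic, so the complex structure is the
  constant map \<open>J0\<close>; closedness of \<omega> then makes it commute with the Christoffel
  symbols and hence with curvature. All later work is algebra at one point: a unitary frame replaces
  every contraction with the inverse metric by plain sums, and W^- becomes a symmetric 3 by 3
  matrix.\<close>

lemma second_difference_mean_value:
  fixes f :: "'a::real_normed_vector \<Rightarrow> real"
  assumes f: "\<And>y. y \<in> ball x r \<Longrightarrow> (f has_derivative f' y) (at y)"
    and f': "\<And>y. y \<in> ball x r \<Longrightarrow> ((\<lambda>y. f' y u) has_derivative f'' y) (at y)"
    and h: "0 < h" "h * (norm u + norm v) < r"
  shows "\<exists>p. dist x p \<le> h * (norm u + norm v) \<and>
    f (x + h *\<^sub>R u + h *\<^sub>R v) - f (x + h *\<^sub>R u) - f (x + h *\<^sub>R v) + f x = h * h * f'' p v"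
proof -
  have near: "dist x (x + s *\<^sub>R u + t *\<^sub>R v) \<le> h * (norm u + norm v)"
    if "0 \<le> s" "s \<le> h" "0 \<le> t" "t \<le> h" for s t
  proof -
    have "norm (s *\<^sub>R u + t *\<^sub>R v) \<le> norm (s *\<^sub>R u) + norm (t *\<^sub>R v)"
      by (rule norm_triangle_ineq)
    also have "\<dots> \<le> h * norm u + h * norm v"
      using that by (intro add_mono) (auto intro!: mult_right_mono)
    finally show ?thesis
      by (simp add: dist_norm algebra_simps norm_minus_commute)
  qed
  have mem: "x + s *\<^sub>R u + t *\<^sub>R v \<in> ball x r"
    if "0 \<le> s" "s \<le> h" "0 \<le> t" "t \<le> h" for s t
    using near[OF that] h by simp
  \<comment> \<open>Mean value theorem twice: first for the difference in direction v as a function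
    of s, then for \<open>f' _ u\<close> as a function of t. The summand
    \<open>0 *\<^sub>R v\<close> is kept so that \<open>der\<close> covers both terms, with t = h
    and t = 0.\<close>
  define \<phi> where "\<phi> s = f (x + s *\<^sub>R u + h *\<^sub>R v) - f (x + s *\<^sub>R u + 0 *\<^sub>R v)" for s
  have der: "((\<lambda>s. f (x + s *\<^sub>R u + t *\<^sub>R v)) has_real_derivative f' (x + s *\<^sub>R u + t *\<^sub>R v) u) (at s)"
    if "0 \<le> s" "s \<le> h" "0 \<le> t" "t \<le> h" for s t
  proof -
    note d = f[OF mem[OF that]]
    have "((\<lambda>s. x + s *\<^sub>R u + t *\<^sub>R v) has_derivative (\<lambda>k. k *\<^sub>R u)) (at s)"
      by (auto intro!: derivative_eq_intros)
    from has_derivative_compose[OF this d]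
    have "((\<lambda>s. f (x + s *\<^sub>R u + t *\<^sub>R v)) has_derivative (\<lambda>k. f' (x + s *\<^sub>R u + t *\<^sub>R v) (k *\<^sub>R u))) (at s)"
      by (simp add: o_def)
    moreover have "(\<lambda>k. f' (x + s *\<^sub>R u + t *\<^sub>R v) (k *\<^sub>R u)) = (*) (f' (x + s *\<^sub>R u + t *\<^sub>R v) u)"
      using linear_cmul[OF has_derivative_linear[OF d]] by (auto simp: mult.commute)
    ultimately show ?thesis by (simp add: has_field_derivative_def)
  qed
  have "\<exists>s>0. s < h \<and> \<phi> h - \<phi> 0 = (h - 0) *
      (f' (x + s *\<^sub>R u + h *\<^sub>R v) u - f' (x + s *\<^sub>R u + 0 *\<^sub>R v) u)"
    unfolding \<phi>_def using h by (intro MVT2) (auto intro!: DERIV_diff der simp del: scaleR_zero_left)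
  then obtain s where s: "0 < s" "s < h"
    and eq1: "\<phi> h - \<phi> 0 = h * (f' (x + s *\<^sub>R u + h *\<^sub>R v) u - f' (x + s *\<^sub>R u + 0 *\<^sub>R v) u)"
    by auto
  have der': "((\<lambda>t. f' (x + s *\<^sub>R u + t *\<^sub>R v) u) has_real_derivative f'' (x + s *\<^sub>R u + t *\<^sub>R v) v) (at t)"
    if "0 \<le> t" "t \<le> h" for t
  proof -
    have "x + s *\<^sub>R u + t *\<^sub>R v \<in> ball x r" using mem[of s t] s that by simp
    note d = f'[OF this]
    have "((\<lambda>t. x + s *\<^sub>R u + t *\<^sub>R v) has_derivative (\<lambda>k. k *\<^sub>R v)) (at t)"
      by (auto intro!: derivative_eq_intros)
    from has_derivative_compose[OF this d]
    have "((\<lambda>t. f' (x + s *\<^sub>R u + t *\<^sub>R v) u) has_derivative (\<lambda>k. f'' (x + s *\<^sub>R u + t *\<^sub>R v) (k *\<^sub>R v))) (at t)"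
      by (simp add: o_def)
    moreover have "(\<lambda>k. f'' (x + s *\<^sub>R u + t *\<^sub>R v) (k *\<^sub>R v)) = (*) (f'' (x + s *\<^sub>R u + t *\<^sub>R v) v)"
      using linear_cmul[OF has_derivative_linear[OF d]] by (auto simp: mult.commute)
    ultimately show ?thesis by (simp add: has_field_derivative_def)
  qed
  have "\<exists>t>0. t < h \<and> f' (x + s *\<^sub>R u + h *\<^sub>R v) u - f' (x + s *\<^sub>R u + 0 *\<^sub>R v) u
      = (h - 0) * f'' (x + s *\<^sub>R u + t *\<^sub>R v) v"
    using h by (intro MVT2[of _ _ "\<lambda>t. f' (x + s *\<^sub>R u + t *\<^sub>R v) u"]) (auto intro!: der')
  then obtain t where t: "0 < t" "t < h"
    and eq2: "f' (x + s *\<^sub>R u + h *\<^sub>R v) u - f' (x + s *\<^sub>R u + 0 *\<^sub>R v) u = h * f'' (x + s *\<^sub>R u + t *\<^sub>R v) v"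
    by auto
  have "f (x + h *\<^sub>R u + h *\<^sub>R v) - f (x + h *\<^sub>R u) - f (x + h *\<^sub>R v) + f x = \<phi> h - \<phi> 0"
    by (simp add: \<phi>_def)
  also have "\<dots> = h * h * f'' (x + s *\<^sub>R u + t *\<^sub>R v) v"
    using eq1 eq2 by simp
  finally show ?thesis using near[of s t] s t by (intro exI[of _ "x + s *\<^sub>R u + t *\<^sub>R v"]) auto
qed

text \<open>The second difference is symmetric in u and v, so both mixed derivatives take the same
  value at points p and q arbitrarily near x. Continuity carries the equality to x.\<close>

lemma second_derivative_symmetric:
  fixes f :: "'a::real_normed_vector \<Rightarrow> real"
  assumes S: "open S" "x \<in> S"
    and f: "\<And>y. y \<in> S \<Longrightarrow> (f has_derivative f' y) (at y)"
    and fu: "\<And>y. y \<in> S \<Longrightarrow> ((\<lambda>y. f' y u) has_derivative fu y) (at y)"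
    and fv: "\<And>y. y \<in> S \<Longrightarrow> ((\<lambda>y. f' y v) has_derivative fv y) (at y)"
    and cu: "continuous_on S (\<lambda>y. fu y v)" and cv: "continuous_on S (\<lambda>y. fv y u)"
  shows "fu x v = fv x u"
proof (rule ccontr)
  assume ne: "fu x v \<noteq> fv x u"
  define e where "e = dist (fu x v) (fv x u) / 2"
  have e: "e > 0" using ne by (simp add: e_def)
  obtain r where r: "r > 0" "ball x r \<subseteq> S" using S openE by blast
  have "isCont (\<lambda>y. fu y v) x" "isCont (\<lambda>y. fv y u) x"
    using cu cv S continuous_on_eq_continuous_at by blast+
  then obtain d1 d2 where d1: "d1 > 0" "\<And>y. dist y x < d1 \<Longrightarrow> dist (fu y v) (fu x v) < e"
    and d2: "d2 > 0" "\<And>y. dist y x < d2 \<Longrightarrow> dist (fv y u) (fv x u) < e"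
    using e unfolding continuous_at_eps_delta by metis
  define m where "m = min r (min d1 d2)"
  have m: "m > 0" "m \<le> r" "m \<le> d1" "m \<le> d2" using r d1 d2 by (auto simp: m_def)
  \<comment> \<open>The added 1 keeps N positive when u and v both vanish.\<close>
  define N where "N = norm u + norm v + 1"
  have N: "N > 0" "norm u + norm v < N" unfolding N_def by (auto intro: add_nonneg_pos)
  define h where "h = m / N"
  have h: "h > 0" using m N by (simp add: h_def)
  have hN: "h * (norm u + norm v) < m"
    using mult_strict_left_mono[OF N(2) h] N(1) by (simp add: h_def)
  have sub: "y \<in> S" if "y \<in> ball x r" for y using r that by blast
  have hr: "h * (norm u + norm v) < r" "h * (norm v + norm u) < r" using hN m by (auto simp: add.commute)
  obtain p where p: "dist x p \<le> h * (norm u + norm v)"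
    "f (x + h *\<^sub>R u + h *\<^sub>R v) - f (x + h *\<^sub>R u) - f (x + h *\<^sub>R v) + f x = h * h * fu p v"
    using second_difference_mean_value[OF f[OF sub] fu[OF sub] h hr(1)] by blast
  obtain q where q: "dist x q \<le> h * (norm v + norm u)"
    "f (x + h *\<^sub>R v + h *\<^sub>R u) - f (x + h *\<^sub>R v) - f (x + h *\<^sub>R u) + f x = h * h * fv q u"
    using second_difference_mean_value[OF f[OF sub] fv[OF sub] h hr(2)] by blast
  have "x + h *\<^sub>R v + h *\<^sub>R u = x + h *\<^sub>R u + h *\<^sub>R v" by (simp add: algebra_simps)
  note q(2)[unfolded this]
  then have "h * h * fu p v = h * h * fv q u" using p(2) by linarith
  then have eq: "fu p v = fv q u" using h by simp
  have "dist (fu p v) (fu x v) < e" using d1(2)[of p] p(1) hN m by (simp add: dist_commute)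
  moreover have "dist (fv q u) (fv x u) < e" using d2(2)[of q] q(1) hN m by (simp add: dist_commute add.commute)
  ultimately have "dist (fu x v) (fv x u) < dist (fu x v) (fv x u)"
    unfolding eq e_def by (rule dist_triangle_half_r)
  then show False by simp
qed

lemma pd_commute:
  assumes "open U" "x \<in> U" "Ck_on 2 U f"
  shows "pd i (pd j f) x = pd j (pd i f) x"
proof -
  have c: "\<forall>y\<in>U. f differentiable (at y)" "\<forall>i. \<forall>y\<in>U. pd i f differentiable (at y)"
    "\<forall>i j. continuous_on U (pd i (pd j f))"
    using assms(3) by (auto simp: numeral_2_eq_2)
  have d1: "(f has_derivative frechet_derivative f (at y)) (at y)" if "y \<in> U" for y
    using c(1) that frechet_derivative_works by blast
  have d2: "((\<lambda>y. frechet_derivative f (at y) (axis k 1)) has_derivative frechet_derivative (pd k f) (at y)) (at y)"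
    if "y \<in> U" for y k
    using c(2) that by (simp add: frechet_derivative_works[symmetric] pd_def[abs_def])
  have d3: "continuous_on U (\<lambda>y. frechet_derivative (pd k f) (at y) (axis l 1))" for k l
    using c(3) by (simp add: pd_def[abs_def])
  have "frechet_derivative (pd j f) (at x) (axis i 1) = frechet_derivative (pd i f) (at x) (axis j 1)"
    by (rule second_derivative_symmetric[OF assms(1,2) d1 d2 d2 d3 d3])
  then show ?thesis by (simp add: pd_def)
qed

section \<open>Multilinear forms and matrices\<close>

lemma linear_axis_expansion:
  fixes f :: "real^'n \<Rightarrow> 'b::real_vector"
  assumes "linear f"
  shows "f u = (\<Sum>i\<in>UNIV. u $ i *\<^sub>R f (axis i 1))"
proof -
  have "f u = f (\<Sum>i\<in>UNIV. u $ i *\<^sub>R axis i 1)"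
    using basis_expansion[of u] by (simp add: scalar_mult_eq_scaleR)
  then show ?thesis by (simp add: linear_sum[OF assms] linear_cmul[OF assms] o_def)
qed

lemma linear_eq_axis:
  fixes f g :: "real^'n \<Rightarrow> 'b::real_vector"
  assumes "linear f" "linear g" "\<And>i. f (axis i 1) = g (axis i 1)"
  shows "f u = g u"
  using linear_axis_expansion[OF assms(1), of u] linear_axis_expansion[OF assms(2), of u] assms(3) by simp

lemma bilinear_axis_expansion:
  fixes T :: "real^4 \<Rightarrow> real^4 \<Rightarrow> real"
  assumes "\<And>v. linear (\<lambda>u. T u v)" "\<And>u. linear (\<lambda>v. T u v)"
  shows "T u v = (\<Sum>k\<in>UNIV. \<Sum>l\<in>UNIV. u $ k * v $ l * T (axis k 1) (axis l 1))"
  using linear_axis_expansion[OF assms(1), of u v] linear_axis_expansion[OF assms(2), of _ v]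
  by (simp add: sum_distrib_left mult_ac)

text \<open>Tensor identities are checked on coordinate vectors, where the definitions by components
  apply, and then hold for all vectors.\<close>

lemma trilinear_eq_axis:
  fixes f g :: "real^'n \<Rightarrow> real^'n \<Rightarrow> real^'n \<Rightarrow> 'b::real_vector"
  assumes "\<And>v w. linear (\<lambda>u. f u v w)" "\<And>u w. linear (\<lambda>v. f u v w)" "\<And>u v. linear (\<lambda>w. f u v w)"
    and "\<And>v w. linear (\<lambda>u. g u v w)" "\<And>u w. linear (\<lambda>v. g u v w)" "\<And>u v. linear (\<lambda>w. g u v w)"
    and "\<And>i j k. f (axis i 1) (axis j 1) (axis k 1) = g (axis i 1) (axis j 1) (axis k 1)"
  shows "f u v w = g u v w"
proof -
  have "f (axis i 1) (axis j 1) w = g (axis i 1) (axis j 1) w" for i j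
    using assms(3,6,7) by (rule linear_eq_axis)
  from linear_eq_axis[OF assms(2,5) this] have "f (axis i 1) v w = g (axis i 1) v w" for i .
  from linear_eq_axis[OF assms(1,4) this] show ?thesis .
qed

text \<open>The six coefficients are the Pluecker coordinates of the bivector of the two
  arguments.\<close>

lemma alternating_combination:
  fixes T :: "'v::real_vector \<Rightarrow> 'v \<Rightarrow> real"
  assumes "\<And>v. linear (\<lambda>u. T u v)" "\<And>u. linear (\<lambda>v. T u v)" and alt: "\<And>u v. T u v = - T v u"
  shows "T (u1 *\<^sub>R e1 + u2 *\<^sub>R e2 + u3 *\<^sub>R e3 + u4 *\<^sub>R e4) (v1 *\<^sub>R e1 + v2 *\<^sub>R e2 + v3 *\<^sub>R e3 + v4 *\<^sub>R e4) =
    (u1 * v2 - u2 * v1) * T e1 e2 + (u1 * v3 - u3 * v1) * T e1 e3 + (u1 * v4 - u4 * v1) * T e1 e4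
    + (u2 * v3 - u3 * v2) * T e2 e3 + (u2 * v4 - u4 * v2) * T e2 e4 + (u3 * v4 - u4 * v3) * T e3 e4"
proof -
  have "T u u = 0" for u using alt[of u u] by simp
  then show ?thesis
    by (simp add: linear_add[OF assms(1)] linear_cmul[OF assms(1)] linear_add[OF assms(2)] linear_cmul[OF assms(2)]
      alt[of e2 e1] alt[of e3 e1] alt[of e4 e1] alt[of e3 e2] alt[of e4 e2] alt[of e4 e3])
      (simp add: algebra_simps)
qed

text \<open>Differentiates an identity that holds throughout an open set; this passes symmetries of
  the metric and of the connection on to their derivatives.\<close>

lemma has_derivative_unique_on_open:
  assumes "(f has_derivative f') (at x)" "(g has_derivative g') (at x)"
    and "open U" "x \<in> U" "\<And>y. y \<in> U \<Longrightarrow> f y = g y"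
  shows "f' a = g' a"
  using has_derivative_unique[OF has_derivative_transform_within_open[OF assms(1,3,4,5)] assms(2)] by simp

lemma has_derivative_component:
  "(f has_derivative f') F \<Longrightarrow> ((\<lambda>x. f x $ i) has_derivative (\<lambda>x. f' x $ i)) F"
  by (rule bounded_linear.has_derivative[OF bounded_linear_vec_nth])

lemma has_derivative_vec_lambda:
  fixes f :: "'a::real_normed_vector \<Rightarrow> real^'n"
  assumes "\<And>i. ((\<lambda>x. f x $ i) has_derivative (\<lambda>a. f' a $ i)) (at x)"
  shows "(f has_derivative f') (at x)"
  unfolding has_derivative_componentwise_within[of f]
  using assms by (auto simp: Basis_vec_def inner_axis)

lemma frechet_derivative_axis_expansion:
  fixes f :: "real^4 \<Rightarrow> real"
  assumes "f differentiable (at x)"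
  shows "frechet_derivative f (at x) a = (\<Sum>i\<in>UNIV. a $ i * pd i f x)"
  using linear_axis_expansion[OF linear_frechet_derivative[OF assms], of a] by (simp add: pd_def)

lemma vector_4:
  "(vector [a, b, c, d] :: 'a::zero^4) $ 1 = a" "(vector [a, b, c, d] :: 'a^4) $ 2 = b"
  "(vector [a, b, c, d] :: 'a^4) $ 3 = c" "(vector [a, b, c, d] :: 'a^4) $ 4 = d"
  unfolding vector_def by simp_all

lemma J0_nth: "J0 v $ 1 = - (v $ 2)" "J0 v $ 2 = v $ 1" "J0 v $ 3 = - (v $ 4)" "J0 v $ 4 = v $ 3"
  by (simp_all add: J0_def vector_4)

lemma linear_J0: "linear J0"
  by (rule linearI) (simp_all add: vec_eq_iff forall_4 J0_nth)

lemma linear_J0_rules: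
  "J0 (u + v) = J0 u + J0 v" "J0 (c *\<^sub>R u) = c *\<^sub>R J0 u" "J0 (u - v) = J0 u - J0 v" "J0 (- u) = - J0 u"
  using linear_add[OF linear_J0] linear_cmul[OF linear_J0] linear_diff[OF linear_J0] linear_neg[OF linear_J0] by auto

lemma J0_has_derivative: "(f has_derivative f') F \<Longrightarrow> ((\<lambda>x. J0 (f x)) has_derivative (\<lambda>a. J0 (f' a))) F"
  using bounded_linear.has_derivative linear_J0 linear_conv_bounded_linear by blast

lemma J0_J0 [simp]: "J0 (J0 v) = - v"
  by (simp add: vec_eq_iff forall_4 J0_nth)

lemma ip_sum: "ip G x u v = (\<Sum>i\<in>UNIV. \<Sum>j\<in>UNIV. u $ i * v $ j * G x $ i $ j)"
  by (simp add: ip_def inner_vec_def matrix_vector_mult_def sum_distrib_left mult_ac)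

lemma linear_ip_left: "linear (\<lambda>u. ip G x u v)"
  by (rule linearI) (simp_all add: ip_def inner_add_left)

lemma linear_ip_right: "linear (\<lambda>v. ip G x u v)"
  using linear_compose[OF matrix_vector_mul_linear, of "\<lambda>v. u \<bullet> v" "G x"]
  by (simp add: ip_def[abs_def] o_def bounded_linear.linear bounded_linear_inner_right)

lemmas linear_ip_rules =
  linear_add[OF linear_ip_left] linear_cmul[OF linear_ip_left] linear_add[OF linear_ip_right] linear_cmul[OF linear_ip_right]
  linear_diff[OF linear_ip_left] linear_diff[OF linear_ip_right] linear_neg[OF linear_ip_left] linear_neg[OF linear_ip_right]

lemma ip_axis: "ip G x (axis i 1) (axis j 1) = G x $ i $ j"
  unfolding ip_def matrix_vector_mult_basis by (simp add: inner_axis' column_def)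

text \<open>In \<open>ip G' a\<close> the derivative matrix stands in place of the metric, and the
  direction a in place of the base point.\<close>

lemma ip_has_derivative:
  assumes "\<And>i j. ((\<lambda>y. G y $ i $ j) has_derivative (\<lambda>a. G' a $ i $ j)) (at x)"
    and "(f has_derivative f') (at x)" "(h has_derivative h') (at x)"
  shows "((\<lambda>y. ip G y (f y) (h y)) has_derivative
    (\<lambda>a. ip G' a (f x) (h x) + ip G x (f' a) (h x) + ip G x (f x) (h' a))) (at x)"
proof -
  have "((\<lambda>y. \<Sum>i\<in>UNIV. \<Sum>j\<in>UNIV. f y $ i * h y $ j * G y $ i $ j) has_derivative
    (\<lambda>a. \<Sum>i\<in>UNIV. \<Sum>j\<in>UNIV. f x $ i * h x $ j * G' a $ i $ j
       + (f x $ i * h' a $ j + f' a $ i * h x $ j) * G x $ i $ j)) (at x)"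
    by (intro has_derivative_sum has_derivative_mult has_derivative_component assms)
  then show ?thesis
    by (simp add: ip_sum sum.distrib distrib_right add_ac)
qed

lemma det_differentiable:
  fixes F :: "'a::real_normed_vector \<Rightarrow> real^'n^'n"
  assumes "\<And>i j. (\<lambda>y. F y $ i $ j) differentiable (at x)"
  shows "(\<lambda>y. det (F y)) differentiable (at x)"
proof -
  obtain F' where F': "\<And>i j. ((\<lambda>y. F y $ i $ j) has_derivative F' i j) (at x)"
    using assms unfolding differentiable_def by metis
  have D: "((\<lambda>y. \<Prod>i\<in>UNIV. F y $ i $ p i) has_derivative
    (\<lambda>a. \<Sum>i\<in>UNIV. F' i (p i) a * (\<Prod>j\<in>UNIV - {i}. F x $ j $ p j))) (at x)" for p :: "'n \<Rightarrow> 'n"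
    by (rule has_derivative_prod) (rule F')
  have "(\<lambda>y. \<Prod>i\<in>UNIV. F y $ i $ p i) differentiable (at x)" for p :: "'n \<Rightarrow> 'n"
    using D by (rule differentiableI)
  then show ?thesis unfolding det_def
    by (intro differentiable_sum ballI differentiable_mult differentiable_const finite_permutations finite)
qed

text \<open>Cramer's rule. It makes the entries of the inverse metric quotients of determinants,
  from which their differentiability, and that of the Christoffel symbols, follows.\<close>

lemma matrix_inv_nth:
  fixes A :: "real^'n^'n"
  assumes "det A \<noteq> 0"
  shows "matrix_inv A $ k $ l = det (\<chi> i j. if j = k then axis l 1 $ i else A $ i $ j) / det A"
proof -
  have "\<exists>A'. A ** A' = mat 1 \<and> A' ** A = mat 1"
    using assms invertible_det_nz[of A] by (simp add: invertible_def)
  then have "A ** matrix_inv A = mat 1" unfolding matrix_inv_def by (rule someI2_ex) simp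
  then have "A *v (matrix_inv A *v axis l 1) = axis l 1"
    by (simp add: matrix_vector_mul_assoc)
  then have "matrix_inv A *v axis l 1 = (\<chi> k. det (\<chi> i j. if j = k then axis l 1 $ i else A $ i $ j) / det A)"
    by (simp only: cramer[OF assms])
  then have "(matrix_inv A *v axis l 1) $ k = det (\<chi> i j. if j = k then axis l 1 $ i else A $ i $ j) / det A"
    by simp
  then show ?thesis unfolding matrix_vector_mult_basis by (simp add: column_def)
qed

lemma matrix_inv_differentiable:
  fixes F :: "'a::real_normed_vector \<Rightarrow> real^'n^'n"
  assumes "\<And>i j. (\<lambda>y. F y $ i $ j) differentiable (at x)"
    and U: "open U" "x \<in> U" "\<And>y. y \<in> U \<Longrightarrow> det (F y) \<noteq> 0"
  shows "(\<lambda>y. matrix_inv (F y) $ k $ l) differentiable (at x)"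
proof -
  have "(\<lambda>y. (\<chi> i j. if j = k then axis l 1 $ i else F y $ i $ j) $ i $ j) differentiable at x" for i j
    using assms(1) by (cases "j = k") simp_all
  then have "(\<lambda>y. det (\<chi> i j. if j = k then axis l 1 $ i else F y $ i $ j)) differentiable (at x)"
    by (rule det_differentiable[where F = "\<lambda>y. \<chi> i j. if j = k then axis l 1 $ i else F y $ i $ j"])
  then have "(\<lambda>y. det (\<chi> i j. if j = k then axis l 1 $ i else F y $ i $ j) / det (F y)) differentiable (at x)"
    by (rule differentiable_divide) (rule det_differentiable assms(1) U)+
  then obtain D where "((\<lambda>y. det (\<chi> i j. if j = k then axis l 1 $ i else F y $ i $ j) / det (F y))
      has_derivative D) (at x)"
    unfolding differentiable_def ..
  then have "((\<lambda>y. matrix_inv (F y) $ k $ l) has_derivative D) (at x)"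
    by (rule has_derivative_transform_within_open[OF _ U(1,2)]) (simp add: matrix_inv_nth U(3))
  then show ?thesis
    by (rule differentiableI)
qed

section \<open>The Levi-Civita connection in a chart\<close>

lemma sum_axis_mult:
  fixes f :: "'n::finite \<Rightarrow> real"
  shows "(\<Sum>k\<in>UNIV. axis m 1 $ k * f k) = f m"
  by (simp add: axis_def if_distrib[where f = "\<lambda>a. a * _"] cong: if_cong)

lemma sum_sum_axis_mult:
  fixes f :: "'n::finite \<Rightarrow> 'n \<Rightarrow> real"
  shows "(\<Sum>k\<in>UNIV. \<Sum>l\<in>UNIV. axis m 1 $ k * axis n 1 $ l * f k l) = f m n"
  by (simp add: mult.assoc sum_distrib_left[symmetric] sum_axis_mult)

locale metric_chart =
  fixes G :: "real^4 \<Rightarrow> real^4^4" and U :: "(real^4) set"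
  assumes U_open: "open U"
    and smooth: "\<And>i j. smooth_on U (\<lambda>x. G x $ i $ j)"
    and symmetric: "\<And>x. x \<in> U \<Longrightarrow> transpose (G x) = G x"
    and positive: "\<And>x v. x \<in> U \<Longrightarrow> v \<noteq> 0 \<Longrightarrow> ip G x v v > 0"
begin

lemma G_Ck: "Ck_on 2 U (\<lambda>x. G x $ i $ j)"
  using smooth unfolding smooth_on_def by blast

lemma G_differentiable: "x \<in> U \<Longrightarrow> (\<lambda>y. G y $ i $ j) differentiable (at x)"
  and pd_G_differentiable: "x \<in> U \<Longrightarrow> pd k (\<lambda>y. G y $ i $ j) differentiable (at x)"
  using G_Ck[of i j] by (simp_all add: numeral_2_eq_2)

lemma G_nth_commute: "x \<in> U \<Longrightarrow> G x $ i $ j = G x $ j $ i"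
  using arg_cong[OF symmetric, of x "\<lambda>A. A $ j $ i"] by (simp add: transpose_def)

lemma ip_commute: "x \<in> U \<Longrightarrow> ip G x u v = ip G x v u"
  unfolding ip_sum by (subst sum.swap) (simp add: G_nth_commute mult_ac)

lemma nondegenerate:
  assumes "x \<in> U" "\<And>z. ip G x u z = ip G x v z"
  shows "u = v"
proof (rule ccontr)
  assume "u \<noteq> v"
  then have "ip G x (u - v) (u - v) > 0" using positive assms(1) by simp
  then show False using assms(2)[of "u - v"] linear_diff[OF linear_ip_left[of G x "u - v"]] by simp
qed

lemma det_G_nonzero: "x \<in> U \<Longrightarrow> det (G x) \<noteq> 0"
proof -
  assume x: "x \<in> U"
  have "v = 0" if "G x *v v = 0" for v
    using positive[OF x, of v] that by (force simp: ip_def)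
  then show ?thesis
    using invertible_det_nz matrix_left_invertible_ker invertible_left_inverse by blast
qed

lemma matrix_inv_G: "x \<in> U \<Longrightarrow> matrix_inv (G x) ** G x = mat 1"
  and G_matrix_inv: "x \<in> U \<Longrightarrow> G x ** matrix_inv (G x) = mat 1"
proof -
  assume "x \<in> U"
  then have "\<exists>A'. G x ** A' = mat 1 \<and> A' ** G x = mat 1"
    using det_G_nonzero invertible_det_nz[of "G x"] by (simp add: invertible_def)
  then have "G x ** matrix_inv (G x) = mat 1 \<and> matrix_inv (G x) ** G x = mat 1"
    unfolding matrix_inv_def by (rule someI_ex)
  then show "matrix_inv (G x) ** G x = mat 1" "G x ** matrix_inv (G x) = mat 1" by auto
qed

text \<open>\<open>dip x w u v\<close> is the derivative at \<open>x\<close> in direction \<open>w\<close> of \<open>ip G _ u v\<close> for constant vectors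
  \<open>u\<close>, \<open>v\<close>; \<open>ddip x a w u v\<close> below is the second derivative in directions \<open>a\<close> and \<open>w\<close>.\<close>

definition dip :: "real^4 \<Rightarrow> real^4 \<Rightarrow> real^4 \<Rightarrow> real^4 \<Rightarrow> real" where
  "dip x w u v = (\<Sum>k\<in>UNIV. w $ k * ip (\<lambda>y. \<chi> i j. pd k (\<lambda>y. G y $ i $ j) y) x u v)"

lemma G_has_derivative:
  assumes "x \<in> U"
  shows "((\<lambda>y. G y $ i $ j) has_derivative
    (\<lambda>a. (\<Sum>k\<in>UNIV. a $ k *\<^sub>R (\<chi> i j. pd k (\<lambda>y. G y $ i $ j) x)) $ i $ j)) (at x)"
proof -
  have eq: "frechet_derivative (\<lambda>y. G y $ i $ j) (at x) =
    (\<lambda>a. (\<Sum>k\<in>UNIV. a $ k *\<^sub>R (\<chi> i j. pd k (\<lambda>y. G y $ i $ j) x)) $ i $ j)"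
    using frechet_derivative_axis_expansion[OF G_differentiable[OF assms]] by (auto simp: sum_component)
  show ?thesis
    using G_differentiable[OF assms, of i j] unfolding frechet_derivative_works eq .
qed

lemma ip_sum_matrices:
  "ip (\<lambda>a. \<Sum>k\<in>UNIV. a $ k *\<^sub>R M k) a u v = (\<Sum>k\<in>UNIV. a $ k * ip (\<lambda>y. M k) y u v)"
  unfolding ip_sum
  by (simp add: sum_distrib_left sum_distrib_right sum_component)
     (subst sum.swap, rule sum.cong[OF refl], subst sum.swap, simp add: mult_ac)

lemma ip_product_rule:
  assumes x: "x \<in> U" and "(f has_derivative f') (at x)" "(h has_derivative h') (at x)"
  shows "((\<lambda>y. ip G y (f y) (h y)) has_derivative
    (\<lambda>a. dip x a (f x) (h x) + ip G x (f' a) (h x) + ip G x (f x) (h' a))) (at x)"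
proof -
  have "ip (\<lambda>a. \<Sum>k\<in>UNIV. a $ k *\<^sub>R (\<chi> i j. pd k (\<lambda>y. G y $ i $ j) x)) a u v = dip x a u v" for a u v
    using ip_sum_matrices[of "\<lambda>k. \<chi> i j. pd k (\<lambda>y. G y $ i $ j) x" a u v]
    by (simp add: dip_def ip_def)
  then show ?thesis
    using ip_has_derivative[OF G_has_derivative[OF x] assms(2,3)] by simp
qed

lemma dip_has_derivative:
  assumes "x \<in> U"
  shows "((\<lambda>y. ip G y u v) has_derivative (\<lambda>a. dip x a u v)) (at x)"
  using ip_product_rule[OF assms has_derivative_const has_derivative_const, of u v]
    linear_0[OF linear_ip_left[of G x v]] linear_0[OF linear_ip_right[of G x u]] by simp

lemma dip_axis: "dip x (axis k 1) (axis i 1) (axis j 1) = pd k (\<lambda>y. G y $ i $ j) x"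
  by (simp add: dip_def ip_axis sum_axis_mult)

lemma linear_dip1: "linear (\<lambda>w. dip x w u v)"
  by (rule linearI) (simp_all add: dip_def sum.distrib sum_distrib_left algebra_simps)

lemma linear_dip2: "linear (\<lambda>u. dip x w u v)"
  by (rule linearI) (simp_all add: dip_def sum.distrib sum_distrib_left
      linear_add[OF linear_ip_left] linear_cmul[OF linear_ip_left] algebra_simps)

lemma linear_dip3: "linear (\<lambda>v. dip x w u v)"
  by (rule linearI) (simp_all add: dip_def sum.distrib sum_distrib_left
      linear_add[OF linear_ip_right] linear_cmul[OF linear_ip_right] algebra_simps)

lemma dip_commute: "x \<in> U \<Longrightarrow> dip x w u v = dip x w v u"
  by (rule has_derivative_unique_on_open[OF dip_has_derivative dip_has_derivative U_open])
     (auto intro: ip_commute)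

definition ddip :: "real^4 \<Rightarrow> real^4 \<Rightarrow> real^4 \<Rightarrow> real^4 \<Rightarrow> real^4 \<Rightarrow> real" where
  "ddip x a w u v = (\<Sum>k\<in>UNIV. \<Sum>l\<in>UNIV. a $ k * w $ l *
     ip (\<lambda>y. \<chi> i j. pd k (pd l (\<lambda>y. G y $ i $ j)) y) x u v)"

text \<open>Schwarz's theorem for the metric coefficients, via \<open>pd_commute\<close>.\<close>

lemma ddip_commute: "x \<in> U \<Longrightarrow> ddip x a w u v = ddip x w a u v"
proof -
  assume x: "x \<in> U"
  have "ip (\<lambda>y. \<chi> i j. pd k (pd l (\<lambda>y. G y $ i $ j)) y) x u v =
    ip (\<lambda>y. \<chi> i j. pd l (pd k (\<lambda>y. G y $ i $ j)) y) x u v" for k l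
    unfolding ip_sum vec_lambda_beta using pd_commute[OF U_open x G_Ck, of k l] by simp
  then show ?thesis
    unfolding ddip_def by (subst sum.swap) (simp add: mult.commute)
qed

lemma ddip_has_derivative:
  assumes x: "x \<in> U"
  shows "((\<lambda>y. dip y w u v) has_derivative (\<lambda>a. ddip x a w u v)) (at x)"
proof -
  have d: "((\<lambda>y. pd l (\<lambda>y. G y $ i $ j) y) has_derivative (\<lambda>a. \<Sum>k\<in>UNIV. a $ k * pd k (pd l (\<lambda>y. G y $ i $ j)) x)) (at x)" for l i j
  proof -
    have eq: "frechet_derivative (pd l (\<lambda>y. G y $ i $ j)) (at x) = (\<lambda>a. \<Sum>k\<in>UNIV. a $ k * pd k (pd l (\<lambda>y. G y $ i $ j)) x)"
      using frechet_derivative_axis_expansion[OF pd_G_differentiable[OF x]] by (rule ext)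
    show ?thesis
      using pd_G_differentiable[OF x, of l i j] unfolding frechet_derivative_works eq .
  qed
  have "((\<lambda>y. dip y w u v) has_derivative (\<lambda>a. \<Sum>l\<in>UNIV. w $ l * (\<Sum>i\<in>UNIV. \<Sum>j\<in>UNIV. u $ i * v $ j *
      (\<Sum>k\<in>UNIV. a $ k * pd k (pd l (\<lambda>y. G y $ i $ j)) x)))) (at x)"
    unfolding dip_def ip_sum vec_lambda_beta
    by (intro has_derivative_sum has_derivative_mult_right d)
  moreover have "(\<Sum>l\<in>UNIV. w $ l * (\<Sum>i\<in>UNIV. \<Sum>j\<in>UNIV. u $ i * v $ j *
      (\<Sum>k\<in>UNIV. a $ k * pd k (pd l (\<lambda>y. G y $ i $ j)) x))) = ddip x a w u v" for a
  proof -
    have "(\<Sum>i\<in>UNIV. \<Sum>j\<in>UNIV. u $ i * v $ j * (\<Sum>k\<in>UNIV. a $ k * pd k (pd l (\<lambda>y. G y $ i $ j)) x)) =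
      (\<Sum>k\<in>UNIV. a $ k * ip (\<lambda>y. \<chi> i j. pd k (pd l (\<lambda>y. G y $ i $ j)) y) x u v)" for l
      unfolding ip_sum vec_lambda_beta sum_distrib_left
      by (subst (2) sum.swap, subst sum.swap) (simp add: mult_ac)
    then show ?thesis
      unfolding ddip_def by (subst sum.swap) (simp add: sum_distrib_left mult_ac)
  qed
  ultimately show ?thesis by simp
qed

text \<open>The covariant derivative of the constant vector field \<open>v\<close> in direction \<open>u\<close>; \<open>dGam x a u v\<close> is its
  derivative in direction \<open>a\<close>.\<close>

definition Gam :: "real^4 \<Rightarrow> real^4 \<Rightarrow> real^4 \<Rightarrow> real^4" where
  "Gam x u v = (\<chi> k. \<Sum>i\<in>UNIV. \<Sum>j\<in>UNIV. u $ i * v $ j * christoffel G k i j x)"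

definition dGam :: "real^4 \<Rightarrow> real^4 \<Rightarrow> real^4 \<Rightarrow> real^4 \<Rightarrow> real^4" where
  "dGam x a u v = (\<chi> k. \<Sum>i\<in>UNIV. \<Sum>j\<in>UNIV. u $ i * v $ j * frechet_derivative (christoffel G k i j) (at x) a)"

lemma christoffel_differentiable: "x \<in> U \<Longrightarrow> christoffel G k i j differentiable (at x)"
  unfolding christoffel_def
  by (intro differentiable_mult differentiable_const differentiable_sum finite ballI differentiable_add differentiable_diff
      pd_G_differentiable matrix_inv_differentiable[OF G_differentiable U_open] det_G_nonzero) auto

lemma Gam_has_derivative:
  assumes "x \<in> U"
  shows "((\<lambda>y. Gam y u v) has_derivative (\<lambda>a. dGam x a u v)) (at x)"
proof (rule has_derivative_vec_lambda)
  show "((\<lambda>y. Gam y u v $ k) has_derivative (\<lambda>a. dGam x a u v $ k)) (at x)" for k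
    unfolding Gam_def dGam_def vec_lambda_beta
    using christoffel_differentiable[OF assms] frechet_derivative_works
    by (intro has_derivative_sum has_derivative_mult_right) blast
qed

lemma linear_Gam1: "linear (\<lambda>u. Gam x u v)"
  by (rule linearI) (simp_all add: Gam_def vec_eq_iff sum.distrib sum_distrib_left algebra_simps)

lemma linear_Gam2: "linear (\<lambda>v. Gam x u v)"
  by (rule linearI) (simp_all add: Gam_def vec_eq_iff sum.distrib sum_distrib_left algebra_simps)

lemma linear_dGam1: "x \<in> U \<Longrightarrow> linear (\<lambda>a. dGam x a u v)"
  using Gam_has_derivative has_derivative_linear by blast

lemma linear_dGam2: "linear (\<lambda>u. dGam x a u v)"
  by (rule linearI) (simp_all add: dGam_def vec_eq_iff sum.distrib sum_distrib_left algebra_simps)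

lemma linear_dGam3: "linear (\<lambda>v. dGam x a u v)"
  by (rule linearI) (simp_all add: dGam_def vec_eq_iff sum.distrib sum_distrib_left algebra_simps)

lemma Gam_axis: "Gam x (axis i 1) (axis j 1) $ k = christoffel G k i j x"
  by (simp add: Gam_def sum_sum_axis_mult)

lemma dGam_axis: "dGam x (axis m 1) (axis i 1) (axis j 1) $ k = pd m (christoffel G k i j) x"
  by (simp add: dGam_def pd_def[of m] sum_sum_axis_mult)

lemmas linear_dip_rules =
  linear_add[OF linear_dip1] linear_cmul[OF linear_dip1] linear_neg[OF linear_dip1]
  linear_add[OF linear_dip2] linear_cmul[OF linear_dip2] linear_neg[OF linear_dip2]
  linear_add[OF linear_dip3] linear_cmul[OF linear_dip3] linear_neg[OF linear_dip3]

lemmas linear_Gam_rules =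
  linear_add[OF linear_Gam1] linear_cmul[OF linear_Gam1] linear_neg[OF linear_Gam1]
  linear_add[OF linear_Gam2] linear_cmul[OF linear_Gam2] linear_neg[OF linear_Gam2]

lemmas linear_dGam_rules =
  linear_add[OF linear_dGam1] linear_cmul[OF linear_dGam1]
  linear_add[OF linear_dGam2] linear_cmul[OF linear_dGam2]
  linear_add[OF linear_dGam3] linear_cmul[OF linear_dGam3]

section \<open>Koszul formula, vanishing torsion and metric compatibility\<close>

lemma koszul:
  assumes x: "x \<in> U"
  shows "ip G x (Gam x u v) z = (dip x u v z + dip x v u z - dip x z u v) / 2"
proof (rule trilinear_eq_axis[where f = "\<lambda>u v z. ip G x (Gam x u v) z"
      and g = "\<lambda>u v z. (dip x u v z + dip x v u z - dip x z u v) / 2"])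
  fix i j l
  \<comment> \<open>Lowering the upper index of the Christoffel symbol with G cancels the inverse
    metric in its definition; what remains is the classical combination of first
    derivatives.\<close>
  have inv: "(\<Sum>k\<in>UNIV. G x $ k $ l * matrix_inv (G x) $ k $ m) = (if l = m then 1 else 0)" for m
    using arg_cong[OF G_matrix_inv[OF x], of "\<lambda>A. A $ l $ m"]
    by (simp add: matrix_matrix_mult_def mat_def G_nth_commute[OF x, of l])
  let ?c = "\<lambda>m. pd i (\<lambda>y. G y $ j $ m) x + pd j (\<lambda>y. G y $ i $ m) x - pd m (\<lambda>y. G y $ i $ j) x"
  have "ip G x (Gam x (axis i 1) (axis j 1)) (axis l 1) = (\<Sum>k\<in>UNIV. christoffel G k i j x * G x $ k $ l)"
    using linear_axis_expansion[OF linear_ip_left[of G x "axis l 1"], of "Gam x (axis i 1) (axis j 1)"]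
    by (simp add: ip_axis Gam_axis)
  also have "\<dots> = (\<Sum>k\<in>UNIV. \<Sum>m\<in>UNIV. (1/2) * ?c m * (G x $ k $ l * matrix_inv (G x) $ k $ m))"
    unfolding christoffel_def sum_distrib_right sum_distrib_left by (simp add: mult_ac)
  also have "\<dots> = (\<Sum>m\<in>UNIV. (1/2) * ?c m * (if l = m then 1 else 0))"
    by (subst sum.swap) (simp only: sum_distrib_left[symmetric] inv)
  also have "\<dots> = ?c l / 2" by (simp add: if_distrib[where f = "\<lambda>a. _ * a"] cong: if_cong)
  finally show "ip G x (Gam x (axis i 1) (axis j 1)) (axis l 1) =
      (dip x (axis i 1) (axis j 1) (axis l 1) + dip x (axis j 1) (axis i 1) (axis l 1) - dip x (axis l 1) (axis i 1) (axis j 1)) / 2"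
    by (simp add: dip_axis)
qed (rule linearI; simp add: linear_ip_rules linear_dip_rules linear_Gam_rules algebra_simps add_divide_distrib diff_divide_distrib)+

lemma koszul_mult: "x \<in> U \<Longrightarrow> 2 * ip G x (Gam x u v) z = dip x u v z + dip x v u z - dip x z u v"
  by (simp add: koszul)

lemma Gam_commute:
  assumes x: "x \<in> U"
  shows "Gam x u v = Gam x v u"
proof (rule nondegenerate[OF x])
  show "ip G x (Gam x u v) z = ip G x (Gam x v u) z" for z
    using koszul_mult[OF x, of u v z] koszul_mult[OF x, of v u z] dip_commute[OF x, of z u v] by linarith
qed

lemma dGam_commute: "x \<in> U \<Longrightarrow> dGam x a u v = dGam x a v u"
  by (rule has_derivative_unique_on_open[OF Gam_has_derivative Gam_has_derivative U_open])
     (auto intro: Gam_commute)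

text \<open>Adding the Koszul formulas for (w, u, v) and (w, v, u) cancels the derivatives in
  directions u and v.\<close>

lemma metric_compatible:
  assumes x: "x \<in> U"
  shows "dip x w u v = ip G x (Gam x w u) v + ip G x u (Gam x w v)"
  using ip_commute[OF x, of u "Gam x w v"] koszul_mult[OF x, of w u v] koszul_mult[OF x, of w v u]
    dip_commute[OF x, of w u v] dip_commute[OF x, of u w v] dip_commute[OF x, of v w u]
  by linarith

lemma ddip_commute': "x \<in> U \<Longrightarrow> ddip x a w u v = ddip x a w v u"
  by (rule has_derivative_unique_on_open[OF ddip_has_derivative ddip_has_derivative U_open])
     (auto intro: dip_commute)

text \<open>Differentiates the Koszul formula in direction a. The derivative falling on the metric
  is rewritten by metric compatibility, which gives the two terms quadratic in
  \<open>Gam\<close>.\<close>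

lemma ip_dGam:
  assumes x: "x \<in> U"
  shows "2 * ip G x (dGam x a u v) z = ddip x a u v z + ddip x a v u z - ddip x a z u v
    - 2 * ip G x (Gam x a (Gam x u v)) z - 2 * ip G x (Gam x u v) (Gam x a z)"
proof -
  have "((\<lambda>y. (1/2) * (dip y u v z + dip y v u z - dip y z u v)) has_derivative
    (\<lambda>a. (1/2) * (ddip x a u v z + ddip x a v u z - ddip x a z u v))) (at x)"
    by (intro has_derivative_mult_right has_derivative_diff has_derivative_add ddip_has_derivative x)
  moreover have "ip G y (Gam y u v) z = (1/2) * (dip y u v z + dip y v u z - dip y z u v)" if "y \<in> U" for y
    using koszul[OF that] by simp
  ultimately have "dip x a (Gam x u v) z + ip G x (dGam x a u v) z + ip G x (Gam x u v) 0
      = (1/2) * (ddip x a u v z + ddip x a v u z - ddip x a z u v)"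
    by (rule has_derivative_unique_on_open[OF ip_product_rule[OF x Gam_has_derivative[OF x] has_derivative_const] _ U_open x])
  then show ?thesis using linear_0[OF linear_ip_right[of G x "Gam x u v"]]
    by (simp add: metric_compatible[OF x, of a "Gam x u v"])
qed

section \<open>Symmetries of the Riemann tensor\<close>

lemma linear_curv1: "linear (\<lambda>u. curv G x u v w)"
  by (rule linearI) (simp_all add: curv_def vec_eq_iff sum.distrib sum_distrib_left algebra_simps)

lemma linear_curv2: "linear (\<lambda>v. curv G x u v w)"
  by (rule linearI) (simp_all add: curv_def vec_eq_iff sum.distrib sum_distrib_left algebra_simps)

lemma linear_curv3: "linear (\<lambda>w. curv G x u v w)"
  by (rule linearI) (simp_all add: curv_def vec_eq_iff sum.distrib sum_distrib_left algebra_simps)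

lemma Gam_axis_left: "Gam x (axis i 1) v $ l = (\<Sum>m\<in>UNIV. v $ m * christoffel G l i m x)"
  by (simp add: Gam_def mult.assoc sum_distrib_left[symmetric] sum_axis_mult)

lemma curv_eq_Gam:
  assumes x: "x \<in> U"
  shows "curv G x u v w = dGam x u v w - dGam x v u w + Gam x u (Gam x v w) - Gam x v (Gam x u w)"
proof (rule trilinear_eq_axis[where f = "\<lambda>u v w. curv G x u v w"
      and g = "\<lambda>u v w. dGam x u v w - dGam x v u w + Gam x u (Gam x v w) - Gam x v (Gam x u w)"])
  fix i j k
  have "curv G x (axis i 1) (axis j 1) (axis k 1) $ l = curv_comp G l i j k x" for l
    by (simp add: curv_def mult.assoc sum_distrib_left[symmetric] sum_axis_mult)
  then show "curv G x (axis i 1) (axis j 1) (axis k 1) = dGam x (axis i 1) (axis j 1) (axis k 1) - dGam x (axis j 1) (axis i 1) (axis k 1)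
      + Gam x (axis i 1) (Gam x (axis j 1) (axis k 1)) - Gam x (axis j 1) (Gam x (axis i 1) (axis k 1))"
    by (simp add: vec_eq_iff curv_comp_def dGam_axis Gam_axis_left sum_axis_mult sum_subtractf)
qed (rule linear_curv1 linear_curv2 linear_curv3 linearI; simp add: linear_Gam_rules linear_dGam_rules x algebra_simps)+

lemma curv_antisym: "x \<in> U \<Longrightarrow> curv G x u v w = - curv G x v u w"
  by (simp add: curv_eq_Gam)

text \<open>By symmetry of \<open>Gam\<close> and \<open>dGam\<close> in their vector arguments, the
  terms cancel in pairs in the cyclic sum.\<close>

lemma curv_bianchi: "x \<in> U \<Longrightarrow> curv G x u v w + curv G x v w u + curv G x w u v = 0"
  using Gam_commute[of x u v] Gam_commute[of x v w] Gam_commute[of x u w]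
    dGam_commute[of x u v w] dGam_commute[of x v u w] dGam_commute[of x w u v]
  by (simp add: curv_eq_Gam)

lemma riem_antisym34:
  assumes x: "x \<in> U"
  shows "riem G x u v w z = - riem G x u v z w"
proof -
  \<comment> \<open>The iterated terms \<open>Gam x u (Gam x v w)\<close> of the curvature cancel
    against those of \<open>ip_dGam\<close>. In the result the two terms differentiated along u and
    v agree by Schwarz, and the rest visibly changes sign when w and z are exchanged.\<close>
  have riem: "2 * riem G x u v w z = ddip x u v w z + ddip x u w v z - ddip x u z v w
      - ddip x v u w z - ddip x v w u z + ddip x v z u w
      - 2 * ip G x (Gam x v w) (Gam x u z) + 2 * ip G x (Gam x u w) (Gam x v z)" for w z
    using ip_dGam[OF x, of u v w z] ip_dGam[OF x, of v u w z]
    by (simp add: riem_def curv_eq_Gam[OF x] linear_ip_rules)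
  show ?thesis
    using riem[of w z] riem[of z w] ddip_commute[OF x, of u v w z] ddip_commute[OF x, of u v z w]
      ddip_commute'[OF x, of u w v z] ddip_commute'[OF x, of u z v w]
      ddip_commute'[OF x, of v w u z] ddip_commute'[OF x, of v z u w]
      ip_commute[OF x, of "Gam x v w"] ip_commute[OF x, of "Gam x u w"]
    by simp
qed

lemma riem_antisym12: "x \<in> U \<Longrightarrow> riem G x u v w z = - riem G x v u w z"
  using curv_antisym[of x u v w] by (simp add: riem_def linear_ip_rules)

lemma riem_bianchi:
  assumes "x \<in> U"
  shows "riem G x u v w z + riem G x v w u z + riem G x w u v z = 0"
proof -
  have "ip G x (curv G x u v w + curv G x v w u + curv G x w u v) z = 0"
    unfolding curv_bianchi[OF assms] by (rule linear_0[OF linear_ip_left])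
  then show ?thesis by (simp add: riem_def linear_ip_rules)
qed

text \<open>The usual octahedron argument: four Bianchi identities combined with skew-symmetry in
  each pair.\<close>

lemma riem_pair_symmetric:
  assumes x: "x \<in> U"
  shows "riem G x u v w z = riem G x w z u v"
  using riem_bianchi[OF x, of u v w z] riem_bianchi[OF x, of v w z u]
    riem_bianchi[OF x, of w z u v] riem_bianchi[OF x, of z u v w]
    riem_antisym34[OF x, of v w z u] riem_antisym34[OF x, of w z v u]
    riem_antisym34[OF x, of z u v w] riem_antisym34[OF x, of u v z w]
    riem_antisym12[OF x, of u w z v] riem_antisym34[OF x, of w u z v]
    riem_antisym12[OF x, of v z u w] riem_antisym34[OF x, of z v u w]
  by linarith

lemma linear_riem1: "linear (\<lambda>u. riem G x u v w z)"
  unfolding riem_def using linear_compose[OF linear_curv1 linear_ip_left] by (simp add: o_def)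

lemma linear_riem2: "linear (\<lambda>v. riem G x u v w z)"
  unfolding riem_def using linear_compose[OF linear_curv2 linear_ip_left] by (simp add: o_def)

lemma linear_riem3: "linear (\<lambda>w. riem G x u v w z)"
  unfolding riem_def using linear_compose[OF linear_curv3 linear_ip_left] by (simp add: o_def)

lemma linear_riem4: "linear (\<lambda>z. riem G x u v w z)"
  unfolding riem_def by (rule linear_ip_right)

lemmas linear_riem_rules =
  linear_add[OF linear_riem1] linear_cmul[OF linear_riem1] linear_neg[OF linear_riem1] linear_diff[OF linear_riem1]
  linear_add[OF linear_riem2] linear_cmul[OF linear_riem2] linear_neg[OF linear_riem2] linear_diff[OF linear_riem2]
  linear_add[OF linear_riem3] linear_cmul[OF linear_riem3] linear_neg[OF linear_riem3] linear_diff[OF linear_riem3]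
  linear_add[OF linear_riem4] linear_cmul[OF linear_riem4] linear_neg[OF linear_riem4] linear_diff[OF linear_riem4]

end

section \<open>Kaehler metrics\<close>

locale kaehler_chart = metric_chart +
  assumes hermitian: "\<And>x u v. x \<in> U \<Longrightarrow> ip G x (J0 u) (J0 v) = ip G x u v"
    and closed: "closed_2form_on U (kaehler_form G)"
begin

lemma ip_J0_left: "x \<in> U \<Longrightarrow> ip G x (J0 u) v = - ip G x u (J0 v)"
  using hermitian[of x u "J0 v"] by (simp add: linear_ip_rules)

lemma dip_hermitian: "x \<in> U \<Longrightarrow> dip x a (J0 u) (J0 v) = dip x a u v"
  by (rule has_derivative_unique_on_open[OF dip_has_derivative dip_has_derivative U_open])
     (auto simp: hermitian)

text \<open>As \<open>J0\<close> is constant in the chart, differentiating the Kaehler form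
  differentiates only the metric.\<close>

lemma dip_closed:
  assumes x: "x \<in> U"
  shows "dip x u (J0 v) w + dip x v (J0 w) u + dip x w (J0 u) v = 0"
proof (rule trilinear_eq_axis[where f = "\<lambda>u v w. dip x u (J0 v) w + dip x v (J0 w) u + dip x w (J0 u) v" and g = "\<lambda>u v w. 0"])
  fix i j k
  have "pd i (\<lambda>y. kaehler_form G y (axis j 1) (axis k 1)) x = dip x (axis i 1) (J0 (axis j 1)) (axis k 1)" for i j k
    unfolding pd_def kaehler_form_def using frechet_derivative_at[OF dip_has_derivative[OF x]] by metis
  then show "dip x (axis i 1) (J0 (axis j 1)) (axis k 1) + dip x (axis j 1) (J0 (axis k 1)) (axis i 1) +
        dip x (axis k 1) (J0 (axis i 1)) (axis j 1) = 0"
    using closed x unfolding closed_2form_on_def by metis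
qed (rule linearI; simp add: linear_dip_rules linear_J0_rules algebra_simps)+

text \<open>The complex structure is parallel: it is constant in the chart, so this says that it commutes with
  the Christoffel symbols.\<close>

lemma Gam_J0:
  assumes x: "x \<in> U"
  shows "Gam x u (J0 v) = J0 (Gam x u v)"
proof (rule nondegenerate[OF x])
  fix z
  have swap: "dip x a (J0 b) c = - dip x a b (J0 c)" for a b c
    using dip_hermitian[OF x, of a b "J0 c"] by (simp add: linear_dip_rules)
  \<comment> \<open>Closedness on (u, Jz, Jv) and on (u, z, v) trades the Koszul terms
    differentiated along Jv and z for terms along u, v and Jz, which are those of the Koszul formula
    for \<open>Gam x u v\<close> paired with Jz.\<close>
  have 1: "- dip x u z (J0 v) - dip x (J0 z) v u + dip x (J0 v) u z = 0"
    using dip_closed[OF x, of u "J0 z" "J0 v"] by (simp add: linear_dip_rules dip_hermitian[OF x])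
  have 2: "dip x u (J0 z) v + dip x z (J0 v) u - dip x v u (J0 z) = 0"
    using dip_closed[OF x, of u z v] swap[of v u z] by simp
  have "2 * ip G x (Gam x u (J0 v)) z = - (2 * ip G x (Gam x u v) (J0 z))"
    using koszul_mult[OF x, of u "J0 v" z] koszul_mult[OF x, of u v "J0 z"] 1 2 swap[of u v z] swap[of u z v]
      dip_commute[OF x, of z u "J0 v"] dip_commute[OF x, of "J0 z" u v] dip_commute[OF x, of u v "J0 z"]
      dip_commute[OF x, of u z "J0 v"]
    by linarith
  then show "ip G x (Gam x u (J0 v)) z = ip G x (J0 (Gam x u v)) z"
    by (simp add: ip_J0_left[OF x])
qed

lemma dGam_J0: "x \<in> U \<Longrightarrow> dGam x a u (J0 v) = J0 (dGam x a u v)"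
  by (rule has_derivative_unique_on_open[OF Gam_has_derivative J0_has_derivative[OF Gam_has_derivative] U_open])
     (auto intro: Gam_J0)

lemma curv_J0: "x \<in> U \<Longrightarrow> curv G x u v (J0 w) = J0 (curv G x u v w)"
  by (simp add: curv_eq_Gam dGam_J0 Gam_J0 linear_J0_rules)

lemma riem_J0: "x \<in> U \<Longrightarrow> riem G x u v (J0 w) (J0 z) = riem G x u v w z"
  by (simp add: riem_def curv_J0 hermitian)

end

section \<open>Determinants, Rayleigh quotients and the Hopf map\<close>

lemma det_4:
  "det (A::'a::comm_ring_1^4^4) =
    A$1$1 * (A$2$2 * (A$3$3 * A$4$4 - A$3$4 * A$4$3) - A$2$3 * (A$3$2 * A$4$4 - A$3$4 * A$4$2)
      + A$2$4 * (A$3$2 * A$4$3 - A$3$3 * A$4$2))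
    - A$1$2 * (A$2$1 * (A$3$3 * A$4$4 - A$3$4 * A$4$3) - A$2$3 * (A$3$1 * A$4$4 - A$3$4 * A$4$1)
      + A$2$4 * (A$3$1 * A$4$3 - A$3$3 * A$4$1))
    + A$1$3 * (A$2$1 * (A$3$2 * A$4$4 - A$3$4 * A$4$2) - A$2$2 * (A$3$1 * A$4$4 - A$3$4 * A$4$1)
      + A$2$4 * (A$3$1 * A$4$2 - A$3$2 * A$4$1))
    - A$1$4 * (A$2$1 * (A$3$2 * A$4$3 - A$3$3 * A$4$2) - A$2$2 * (A$3$1 * A$4$3 - A$3$3 * A$4$1)
      + A$2$3 * (A$3$1 * A$4$2 - A$3$2 * A$4$1))"
proof -
  have f: "finite {2::4, 3, 4}" "1 \<notin> {2::4, 3, 4}" "finite {3::4, 4}" "2 \<notin> {3::4, 4}"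
    "finite {4::4}" "3 \<notin> {4::4}"
    by auto
  show ?thesis
    unfolding det_def UNIV_4
    unfolding sum_over_permutations_insert[OF f(1,2)]
    unfolding sum_over_permutations_insert[OF f(3,4)]
    unfolding sum_over_permutations_insert[OF f(5,6)]
    unfolding permutes_sing
    by (simp add: sign_swap_id permutation_swap_id permutation_compose sign_compose sign_id swap_id_eq)
       (simp add: algebra_simps)
qed


section \<open>Extreme eigenvalues as extrema of the quadratic form on the unit sphere\<close>

lemma symmetric_matrix_max_eigenvalue:
  fixes B :: "real^'n^'n"
  assumes sym: "transpose B = B"
  obtains y m where "norm y = 1" "B *v y = m *\<^sub>R y" "\<And>z. norm z = 1 \<Longrightarrow> z \<bullet> (B *v z) \<le> m"
proof -
  let ?q = "\<lambda>z::real^'n. z \<bullet> (B *v z)"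
  have "compact (sphere (0::real^'n) 1)" "sphere (0::real^'n) 1 \<noteq> {}"
    by (auto simp: sphere_eq_empty)
  moreover have "continuous_on (sphere 0 1) ?q"
    by (intro continuous_on_inner continuous_on_id linear_continuous_on
        linear_conv_bounded_linear[THEN iffD1] matrix_vector_mul_linear)
  ultimately obtain y where y: "y \<in> sphere 0 1" "\<And>z. z \<in> sphere 0 1 \<Longrightarrow> ?q z \<le> ?q y"
    using continuous_attains_sup[of "sphere 0 1" ?q] by blast
  define m where "m = ?q y"
  have yn: "norm y = 1" using y(1) by simp
  have max: "?q z \<le> m" if "norm z = 1" for z
    using y(2)[of z] that by (simp add: m_def)
  have bound: "?q z \<le> m * (z \<bullet> z)" for z
  proof (cases "z = 0")
    case False
    have "?q (inverse (norm z) *\<^sub>R z) \<le> m" using False by (intro max) simp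
    moreover have "?q (inverse (norm z) *\<^sub>R z) = ?q z / (z \<bullet> z)"
      by (simp add: matrix_vector_mult_scaleR power2_norm_eq_inner[symmetric] power2_eq_square field_simps)
    moreover have "z \<bullet> z > 0" using False by simp
    ultimately show ?thesis by (simp add: field_simps)
  qed simp
  \<comment> \<open>The nonnegative form \<open>m * (z \<bullet> z) - z \<bullet> (B *v z)\<close>
    vanishes at y. Along y + tw it equals \<open>2 * t * (w \<bullet> w) + t * t * d\<close>, which
    is negative for small t < 0 unless the residual w is zero.\<close>
  define w where "w = m *\<^sub>R y - B *v y"
  define d where "d = m * (w \<bullet> w) - ?q w"
  have d: "d \<ge> 0" using bound[of w] by (simp add: d_def)
  have yy: "y \<bullet> y = 1" using yn by (simp add: dot_square_norm)
  have adj: "u \<bullet> (B *v v) = v \<bullet> (B *v u)" for u v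
    using dot_lmul_matrix[of u B v] transpose_matrix_vector[of B u] sym by (simp add: inner_commute)
  have nonneg: "2 * t * (w \<bullet> w) + t * t * d \<ge> 0" for t
  proof -
    have "?q (y + t *\<^sub>R w) = m + 2 * t * (w \<bullet> (B *v y)) + t * t * ?q w"
      by (simp add: matrix_vector_right_distrib matrix_vector_mult_scaleR inner_add_left inner_add_right
          adj[of y w] m_def algebra_simps)
    moreover have "(y + t *\<^sub>R w) \<bullet> (y + t *\<^sub>R w) = 1 + 2 * t * (w \<bullet> y) + t * t * (w \<bullet> w)"
      using yy by (simp add: inner_add_left inner_add_right inner_commute[of y w] algebra_simps del: dot_square_norm)
    moreover have "w \<bullet> w = m * (w \<bullet> y) - w \<bullet> (B *v y)"
      unfolding w_def by (simp add: inner_diff_right)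
    moreover have "2 * t * W + t * t * (m * W - q) = m * (1 + 2 * t * r + t * t * W) - (m + 2 * t * p + t * t * q)"
      if "W = m * r - p" for W p q r :: real
      unfolding that by (simp add: algebra_simps)
    ultimately show ?thesis using bound[of "y + t *\<^sub>R w"] by (simp add: d_def)
  qed
  \<comment> \<open>A negative multiple of \<open>w \<bullet> w\<close> small enough for the linear
    term to win; d + 1 avoids dividing by zero when d = 0.\<close>
  define t where "t = - (w \<bullet> w) / (d + 1)"
  have t: "t * (d + 1) = - (w \<bullet> w)" using d by (simp add: t_def)
  have "0 \<le> (2 * t * (w \<bullet> w) + t * t * d) * (d + 1)\<^sup>2"
    using nonneg[of t] by simp
  also have "\<dots> = 2 * (t * (d + 1)) * (w \<bullet> w) * (d + 1) + (t * (d + 1))\<^sup>2 * d"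
    by (simp only: power2_eq_square) (simp only: algebra_simps)
  also have "\<dots> = - ((w \<bullet> w)\<^sup>2 * (d + 2))"
    unfolding t by (simp only: power2_eq_square) (simp add: algebra_simps del: dot_square_norm)
  finally have "(w \<bullet> w)\<^sup>2 * (d + 2) \<le> 0" by simp
  then have "w \<bullet> w = 0" using d by (auto simp: mult_le_0_iff)
  then have "B *v y = m *\<^sub>R y" by (simp add: w_def)
  with yn max that show ?thesis by blast
qed

lemma symmetric_matrix_max_eq_largest_eigenvalue:
  fixes B :: "real^'n^'n"
  assumes sym: "transpose B = B"
    and l: "\<exists>y. y \<noteq> 0 \<and> B *v y = l *\<^sub>R y"
    and largest: "\<And>\<mu> y. y \<noteq> 0 \<Longrightarrow> B *v y = \<mu> *\<^sub>R y \<Longrightarrow> \<mu> \<le> l"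
  shows "(\<exists>y. norm y = 1 \<and> y \<bullet> (B *v y) = l) \<and> (\<forall>y. norm y = 1 \<longrightarrow> y \<bullet> (B *v y) \<le> l)"
proof -
  obtain y m where y: "norm y = 1" "B *v y = m *\<^sub>R y" and max: "\<And>z. norm z = 1 \<Longrightarrow> z \<bullet> (B *v z) \<le> m"
    using symmetric_matrix_max_eigenvalue[OF sym] by blast
  have "m \<le> l" using largest[of y m] y by force
  obtain z where z: "z \<noteq> 0" "B *v z = l *\<^sub>R z" using l by blast
  define w where "w = inverse (norm z) *\<^sub>R z"
  have w: "norm w = 1" "B *v w = l *\<^sub>R w"
    using z by (simp_all add: w_def matrix_vector_mult_scaleR)
  have "w \<bullet> (B *v w) = l" using w by (simp add: dot_square_norm)
  then show ?thesis using w max \<open>m \<le> l\<close> by force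
qed

lemma symmetric_matrix_min_eq_smallest_eigenvalue:
  fixes B :: "real^'n^'n"
  assumes sym: "transpose B = B"
    and l: "\<exists>y. y \<noteq> 0 \<and> B *v y = l *\<^sub>R y"
    and smallest: "\<And>\<mu> y. y \<noteq> 0 \<Longrightarrow> B *v y = \<mu> *\<^sub>R y \<Longrightarrow> l \<le> \<mu>"
  shows "(\<exists>y. norm y = 1 \<and> y \<bullet> (B *v y) = l) \<and> (\<forall>y. norm y = 1 \<longrightarrow> l \<le> y \<bullet> (B *v y))"
proof -
  have neg: "(- B) *v y = - (B *v y)" for y
    by (simp add: vec_eq_iff matrix_vector_mult_def sum_negf)
  have "transpose (- B) = - B"
    using sym by (simp add: vec_eq_iff transpose_def)
  then have "(\<exists>y. norm y = 1 \<and> y \<bullet> ((- B) *v y) = - l) \<and> (\<forall>y. norm y = 1 \<longrightarrow> y \<bullet> ((- B) *v y) \<le> - l)"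
  proof (rule symmetric_matrix_max_eq_largest_eigenvalue)
    show "\<exists>y. y \<noteq> 0 \<and> (- B) *v y = (- l) *\<^sub>R y" using l by (simp add: neg)
    show "\<mu> \<le> - l" if "y \<noteq> 0" "(- B) *v y = \<mu> *\<^sub>R y" for \<mu> y
    proof -
      have "B *v y = (- \<mu>) *\<^sub>R y" using that(2) unfolding neg by (simp add: minus_equation_iff[of "B *v y"])
      from smallest[OF that(1) this] show ?thesis by simp
    qed
  qed
  then show ?thesis by (simp add: neg)
qed

lemma hopf_surjective:
  fixes y1 y2 y3 :: real
  assumes "y1\<^sup>2 + y2\<^sup>2 + y3\<^sup>2 = 1"
  obtains x1 x2 x3 x4 where "x1\<^sup>2 + x2\<^sup>2 + x3\<^sup>2 + x4\<^sup>2 = 1" "y1 = x1\<^sup>2 + x2\<^sup>2 - x3\<^sup>2 - x4\<^sup>2"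
    "y2 = 2 * (x2 * x3 - x1 * x4)" "y3 = 2 * (x1 * x3 + x2 * x4)"
proof (cases "y1 = -1")
  case True
  then have "y2\<^sup>2 + y3\<^sup>2 = 0" using assms by simp
  then have "y2 = 0" "y3 = 0" by (simp_all add: sum_power2_eq_zero_iff)
  then show ?thesis using that[of 0 0 1 0] True by simp
next
  case False
  have "y1\<^sup>2 \<le> 1" using assms zero_le_power2[of y2] zero_le_power2[of y3] by linarith
  then have "y1 > -1" using False abs_square_le_1[of y1] by (auto simp: abs_le_iff)
  \<comment> \<open>A fibre of the Hopf map is a circle of phases. The preimage with x2 = 0 and x1 =
    s > 0 is taken; the equations for y3 and y2 then give x3 and x4. Only at y1 = -1 does x1 vanish
    on the whole fibre, hence the separate case.\<close>
  define s where "s = sqrt ((1 + y1) / 2)"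
  have s: "s > 0" "2 * s\<^sup>2 = 1 + y1" using \<open>y1 > -1\<close> by (simp_all add: s_def)
  have e: "(y3 / (2 * s))\<^sup>2 + (- y2 / (2 * s))\<^sup>2 = (1 - y1) / 2"
  proof -
    have "(y3 / (2 * s))\<^sup>2 + (- y2 / (2 * s))\<^sup>2 = (y3\<^sup>2 + y2\<^sup>2) / (2 * (2 * s\<^sup>2))"
      by (simp add: power_divide power_mult_distrib add_divide_distrib)
    also have "y3\<^sup>2 + y2\<^sup>2 = (1 - y1) * (1 + y1)" using assms by (simp add: power2_eq_square algebra_simps)
    also have "(1 - y1) * (1 + y1) / (2 * (2 * s\<^sup>2)) = (1 - y1) / 2"
      using s(1) unfolding s(2)[symmetric] by simp
    finally show ?thesis .
  qed
  moreover define a b where "a = y3 / (2 * s)" and "b = - y2 / (2 * s)"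
  ultimately have e': "2 * (a\<^sup>2 + b\<^sup>2) = 1 - y1" by simp
  show ?thesis
  proof (rule that[of s 0 a b])
    show "s\<^sup>2 + 0\<^sup>2 + a\<^sup>2 + b\<^sup>2 = 1" using e' s(2) by simp
    show "y1 = s\<^sup>2 + 0\<^sup>2 - a\<^sup>2 - b\<^sup>2" using e' s(2) by simp
  qed (use s in \<open>simp_all add: a_def b_def\<close>)
qed

section \<open>Two-forms in a unitary frame\<close>

lemma sum_swap3:
  "(\<Sum>l\<in>C. \<Sum>a\<in>A. \<Sum>b\<in>B. f l a b) = (\<Sum>a\<in>A. \<Sum>b\<in>B. \<Sum>l\<in>C. f l a b)"
  by (subst sum.swap, rule sum.cong[OF refl], rule sum.swap)

text \<open>Coordinates with respect to \<open>e\<^sub>1\<^sub>2 - e\<^sub>3\<^sub>4\<close>, \<open>e\<^sub>1\<^sub>3 + e\<^sub>2\<^sub>4\<close>, \<open>e\<^sub>1\<^sub>4 - e\<^sub>2\<^sub>3\<close>.\<close>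

definition asd_matrix :: "real^3 \<Rightarrow> real^4^4" where
  "asd_matrix y = vector [vector [0, y $ 1, y $ 2, y $ 3], vector [- y $ 1, 0, - y $ 3, y $ 2],
     vector [- y $ 2, y $ 3, 0, - y $ 1], vector [- y $ 3, - y $ 2, y $ 1, 0]]"

lemma asd_matrix_nth:
  "asd_matrix y $ 1 $ 1 = 0" "asd_matrix y $ 1 $ 2 = y $ 1" "asd_matrix y $ 1 $ 3 = y $ 2" "asd_matrix y $ 1 $ 4 = y $ 3"
  "asd_matrix y $ 2 $ 1 = - y $ 1" "asd_matrix y $ 2 $ 2 = 0" "asd_matrix y $ 2 $ 3 = - y $ 3" "asd_matrix y $ 2 $ 4 = y $ 2"
  "asd_matrix y $ 3 $ 1 = - y $ 2" "asd_matrix y $ 3 $ 2 = y $ 3" "asd_matrix y $ 3 $ 3 = 0" "asd_matrix y $ 3 $ 4 = - y $ 1"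
  "asd_matrix y $ 4 $ 1 = - y $ 3" "asd_matrix y $ 4 $ 2 = - y $ 2" "asd_matrix y $ 4 $ 3 = y $ 1" "asd_matrix y $ 4 $ 4 = 0"
  by (simp_all add: asd_matrix_def vector_4)

lemma transpose_asd_matrix: "transpose (asd_matrix y) = - asd_matrix y"
  by (simp add: vec_eq_iff forall_4 transpose_def asd_matrix_nth)

lemma asd_matrix_scaleR: "asd_matrix (c *\<^sub>R y) = c *\<^sub>R asd_matrix y"
  by (simp add: vec_eq_iff forall_4 asd_matrix_nth)

lemma asd_matrix_inject: "asd_matrix y = asd_matrix z \<longleftrightarrow> y = z"
  by (auto simp: vec_eq_iff forall_4 forall_3 asd_matrix_nth)

lemma asd_matrix_eq_0: "asd_matrix y = 0 \<longleftrightarrow> y = 0"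
  by (auto simp: vec_eq_iff forall_4 forall_3 asd_matrix_nth)

text \<open>Hermitian Gram-Schmidt: if v is orthogonal to u and J u, then so is J v, because
  \<open>J0\<close> is skew for the metric.\<close>

lemma (in kaehler_chart) unitary_frame_exists:
  assumes x: "x \<in> U"
  obtains e :: "4 \<Rightarrow> real^4" where "\<And>a b. ip G x (e a) (e b) = (if a = b then 1 else 0)"
    "J0 (e 1) = e 2" "J0 (e 3) = e 4"
proof -
  have normalize: "\<exists>c::real. c \<noteq> 0 \<and> ip G x (c *\<^sub>R v) (c *\<^sub>R v) = 1" if "v \<noteq> 0" for v
  proof (intro exI conjI)
    have p: "ip G x v v > 0" using positive[OF x that] .
    then show "inverse (sqrt (ip G x v v)) \<noteq> 0" by simp
    show "ip G x (inverse (sqrt (ip G x v v)) *\<^sub>R v) (inverse (sqrt (ip G x v v)) *\<^sub>R v) = 1"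
      using p by (simp add: linear_ip_rules field_simps)
  qed
  have JJ: "ip G x u (J0 u) = 0" for u
    using ip_J0_left[OF x, of u u] ip_commute[OF x, of u "J0 u"] by simp
  obtain u where u: "ip G x u u = 1"
    using normalize[of "axis 1 1"] by (auto simp: axis_eq_0_iff)
  have "span {u, J0 u} \<noteq> UNIV"
  proof
    assume "span {u, J0 u} = UNIV"
    then have "dim {u, J0 u} = DIM(real^4)" using dim_eq_full by blast
    moreover have "dim {u, J0 u} \<le> card {u, J0 u}" by (rule dim_le_card') simp
    moreover have "card {u, J0 u} \<le> 2" by (simp add: card_insert_if)
    ultimately show False by simp
  qed
  then obtain w where w: "w \<notin> span {u, J0 u}" by blast
  define w' where "w' = w - ip G x w u *\<^sub>R u - ip G x w (J0 u) *\<^sub>R J0 u"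
  have "w' \<noteq> 0"
  proof
    assume "w' = 0"
    then have "w = ip G x w u *\<^sub>R u + ip G x w (J0 u) *\<^sub>R J0 u" by (simp add: w'_def algebra_simps)
    also have "\<dots> \<in> span {u, J0 u}" by (intro span_add span_scale span_base) auto
    finally show False using w by simp
  qed
  then obtain c where c: "ip G x (c *\<^sub>R w') (c *\<^sub>R w') = 1" using normalize by blast
  define v where "v = c *\<^sub>R w'"
  have v: "ip G x v v = 1" using c by (simp add: v_def)
  have uJ: "ip G x (J0 u) u = 0" using JJ ip_commute[OF x] by metis
  have vu: "ip G x v u = 0" "ip G x v (J0 u) = 0"
    unfolding v_def w'_def by (simp_all add: linear_ip_rules u uJ JJ hermitian[OF x])
  have uv: "ip G x u v = 0" "ip G x (J0 u) v = 0"
    using vu ip_commute[OF x] by metis+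
  have "ip G x (J0 v) u = 0" "ip G x u (J0 v) = 0" "ip G x (J0 v) v = 0"
    using ip_J0_left[OF x, of v u] vu ip_commute[OF x] JJ by (metis neg_0_equal_iff_equal)+
  define e where "e a = (if a = 1 then u else if a = 2 then J0 u else if a = 3 then v else J0 v)" for a :: 4
  show ?thesis
  proof (rule that)
    have "\<forall>a b. ip G x (e a) (e b) = (if a = b then 1 else 0)"
      unfolding forall_4 by (simp add: e_def u v uv vu uJ JJ hermitian[OF x] \<open>ip G x (J0 v) u = 0\<close>
        \<open>ip G x u (J0 v) = 0\<close> \<open>ip G x (J0 v) v = 0\<close>)
    then show "ip G x (e a) (e b) = (if a = b then 1 else 0)" for a b by blast
  qed (simp_all add: e_def)
qed

locale unitary_frame = kaehler_chart +
  fixes x :: "real^4" and e :: "4 \<Rightarrow> real^4"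
  assumes x: "x \<in> U"
    and orthonormal: "\<And>a b. ip G x (e a) (e b) = (if a = b then 1 else 0)"
    and J0_e1: "J0 (e 1) = e 2" and J0_e3: "J0 (e 3) = e 4"
begin

lemma J0_e2: "J0 (e 2) = - e 1" and J0_e4: "J0 (e 4) = - e 3"
  by (simp_all add: J0_e1[symmetric] J0_e3[symmetric])

definition P :: "real^4^4" where
  "P = (\<chi> i a. e a $ i)"

definition form_comp :: "real^4^4 \<Rightarrow> real^4^4" where
  "form_comp \<Phi> = transpose P ** \<Phi> ** P"

lemma transpose_P_G_P: "transpose P ** G x ** P = mat 1"
proof -
  have "(transpose P ** G x ** P) $ a $ b = ip G x (e a) (e b)" for a b
    by (simp add: matrix_matrix_mult_def transpose_def P_def ip_sum sum_distrib_left sum_distrib_right)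
       (subst sum.swap, simp add: mult_ac)
  then show ?thesis by (simp add: vec_eq_iff mat_def orthonormal)
qed

lemma P_transpose_P_G: "P ** (transpose P ** G x) = mat 1"
  using transpose_P_G_P matrix_left_right_inverse by blast

lemma matrix_inv_G_eq: "matrix_inv (G x) = P ** transpose P"
proof -
  have "matrix_inv (G x) = (P ** (transpose P ** G x)) ** matrix_inv (G x)"
    by (simp add: P_transpose_P_G)
  also have "\<dots> = P ** transpose P ** (G x ** matrix_inv (G x))"
    by (simp add: matrix_mul_assoc)
  finally show ?thesis by (simp add: G_matrix_inv[OF x])
qed

lemma frame_expansion: "v = (\<Sum>a\<in>UNIV. ip G x (e a) v *\<^sub>R e a)"
proof -
  have "v = (P ** (transpose P ** G x)) *v v" by (simp add: P_transpose_P_G)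
  also have "\<dots> = P *v (transpose P *v (G x *v v))" by (simp add: matrix_vector_mul_assoc)
  also have "transpose P *v (G x *v v) = (\<chi> a. ip G x (e a) v)"
    by (simp add: vec_eq_iff matrix_vector_mult_def transpose_def P_def ip_def inner_vec_def)
  also have "P *v (\<chi> a. ip G x (e a) v) = (\<Sum>a\<in>UNIV. ip G x (e a) v *\<^sub>R e a)"
    by (simp add: vec_eq_iff matrix_vector_mult_def P_def mult.commute sum_component)
  finally show ?thesis .
qed

lemma form_comp_nth: "form_comp \<Phi> $ a $ b = (\<Sum>i\<in>UNIV. \<Sum>j\<in>UNIV. e a $ i * e b $ j * \<Phi> $ i $ j)"
  unfolding form_comp_def
  by (simp add: matrix_matrix_mult_def transpose_def P_def sum_distrib_left sum_distrib_right)
     (subst sum.swap, simp add: mult_ac)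

text \<open>Every matrix is the frame matrix of some bilinear form. This later turns eigenvectors of
  \<open>B\<close> into two-forms.\<close>

lemma form_comp_inverse: "form_comp (transpose (transpose P ** G x) ** F ** (transpose P ** G x)) = F"
proof -
  have "transpose P ** transpose (transpose P ** G x) = mat 1"
    by (metis matrix_transpose_mul transpose_mat transpose_P_G_P P_transpose_P_G)
  then show ?thesis
    unfolding form_comp_def
    by (metis matrix_mul_assoc matrix_mul_lid matrix_mul_rid transpose_P_G_P)
qed

lemma form_comp_inject: "form_comp \<Phi> = form_comp \<Psi> \<longleftrightarrow> \<Phi> = \<Psi>"
proof
  assume eq: "form_comp \<Phi> = form_comp \<Psi>"
  have "transpose (transpose P ** G x) ** transpose P = mat 1"
    by (metis matrix_transpose_mul transpose_mat P_transpose_P_G)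
  then have "transpose (transpose P ** G x) ** form_comp \<Phi> ** (transpose P ** G x) = \<Phi>" for \<Phi>
    unfolding form_comp_def by (metis matrix_mul_assoc matrix_mul_lid matrix_mul_rid P_transpose_P_G)
  then show "\<Phi> = \<Psi>" using eq by metis
qed simp

text \<open>The inverse metric is \<open>P ** transpose P\<close>, so in an orthonormal frame
  raising indices leaves the components unchanged.\<close>

lemma raise2_nth: "raise2 G x \<Phi> $ k $ l = (\<Sum>a\<in>UNIV. \<Sum>b\<in>UNIV. form_comp \<Phi> $ a $ b * (e a $ k * e b $ l))"
proof -
  have "raise2 G x \<Phi> = P ** form_comp \<Phi> ** transpose P"
    unfolding raise2_def matrix_inv_G_eq form_comp_def
    by (simp add: matrix_transpose_mul matrix_mul_assoc)
  then show ?thesis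
    by (simp add: matrix_matrix_mult_def transpose_def P_def sum_distrib_left sum_distrib_right)
       (subst sum.swap, simp add: mult_ac)
qed

lemma contraction_frame:
  fixes T :: "real^4 \<Rightarrow> real^4 \<Rightarrow> real"
  assumes "\<And>v. linear (\<lambda>u. T u v)" "\<And>u. linear (\<lambda>v. T u v)"
  shows "(\<Sum>k\<in>UNIV. \<Sum>l\<in>UNIV. raise2 G x \<Phi> $ k $ l * T (axis k 1) (axis l 1)) =
    (\<Sum>a\<in>UNIV. \<Sum>b\<in>UNIV. form_comp \<Phi> $ a $ b * T (e a) (e b))"
proof -
  have "(\<Sum>k\<in>UNIV. \<Sum>l\<in>UNIV. raise2 G x \<Phi> $ k $ l * T (axis k 1) (axis l 1)) =
    (\<Sum>k\<in>UNIV. \<Sum>l\<in>UNIV. \<Sum>a\<in>UNIV. \<Sum>b\<in>UNIV.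
      form_comp \<Phi> $ a $ b * (e a $ k * e b $ l * T (axis k 1) (axis l 1)))"
    unfolding raise2_nth by (simp add: sum_distrib_right mult.assoc)
  also have "\<dots> = (\<Sum>a\<in>UNIV. \<Sum>b\<in>UNIV. form_comp \<Phi> $ a $ b *
      (\<Sum>k\<in>UNIV. \<Sum>l\<in>UNIV. e a $ k * e b $ l * T (axis k 1) (axis l 1)))"
    unfolding sum_distrib_left by (rule trans[OF sum.cong[OF refl sum_swap3] sum_swap3])
  finally show ?thesis by (simp only: bilinear_axis_expansion[OF assms, of "e _" "e _"])
qed

lemma det_P_pos: "det P > 0"
proof -
  have e2: "e 2 $ 1 = - (e 1 $ 2)" "e 2 $ 2 = e 1 $ 1" "e 2 $ 3 = - (e 1 $ 4)" "e 2 $ 4 = e 1 $ 3"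
    by (simp_all add: J0_e1[symmetric] J0_nth)
  have e4: "e 4 $ 1 = - (e 3 $ 2)" "e 4 $ 2 = e 3 $ 1" "e 4 $ 3 = - (e 3 $ 4)" "e 4 $ 4 = e 3 $ 3"
    by (simp_all add: J0_e3[symmetric] J0_nth)
  \<comment> \<open>The columns are u, Ju, v, Jv, so the real determinant is the squared modulus of
    the complex 2 by 2 determinant of u and v. This is where the orientation induced by J
    enters.\<close>
  have "det P = (e 1 $ 1 * e 3 $ 3 - e 1 $ 2 * e 3 $ 4 - e 1 $ 3 * e 3 $ 1 + e 1 $ 4 * e 3 $ 2)\<^sup>2
      + (e 1 $ 1 * e 3 $ 4 + e 1 $ 2 * e 3 $ 3 - e 1 $ 3 * e 3 $ 2 - e 1 $ 4 * e 3 $ 1)\<^sup>2"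
    by (simp add: det_4 P_def e2 e4 power2_eq_square algebra_simps)
  then have "det P \<ge> 0" by simp
  moreover have "det P \<noteq> 0"
    using arg_cong[OF transpose_P_G_P, of det] by (auto simp: det_mul)
  ultimately show ?thesis by simp
qed

lemma sqrt_det_G: "sqrt (det (G x)) * det P = 1"
proof -
  have "det P * det (G x) * det P = 1"
    using arg_cong[OF transpose_P_G_P, of det] by (simp add: det_mul det_transpose)
  then have "det (G x) = (1 / det P)\<^sup>2"
    using det_P_pos by (simp add: power2_eq_square field_simps)
  then have "sqrt (det (G x)) = 1 / det P"
    using det_P_pos by (simp add: real_sqrt_divide)
  then show ?thesis using det_P_pos by simp
qed

lemma vol_frame: "vol G x (e a) (e b) (e c) (e d) = det (vector [axis a 1, axis b 1, axis c 1, axis d 1] :: real^4^4)"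
proof -
  have "(vector [e a, e b, e c, e d] :: real^4^4) = vector [axis a 1, axis b 1, axis c 1, axis d 1] ** transpose P"
    by (simp add: vec_eq_iff forall_4[of "\<lambda>i. \<forall>j. _ i j"] vector_4 matrix_matrix_mult_def transpose_def P_def sum_axis_mult)
  then show ?thesis
    using sqrt_det_G by (simp add: vol_def det_mul det_transpose)
qed

text \<open>The pattern shared by the Hodge star and the Weyl operator: a coordinate contraction
  becomes the same sum over the frame.\<close>

lemma form_comp_contraction:
  fixes T :: "real^4 \<Rightarrow> real^4 \<Rightarrow> real^4 \<Rightarrow> real^4 \<Rightarrow> real"
  assumes "\<And>v w z. linear (\<lambda>u. T u v w z)" "\<And>u w z. linear (\<lambda>v. T u v w z)"
    "\<And>u v z. linear (\<lambda>w. T u v w z)" "\<And>u v w. linear (\<lambda>z. T u v w z)"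
  shows "form_comp (\<chi> i j. (1/2) * (\<Sum>k\<in>UNIV. \<Sum>l\<in>UNIV.
      raise2 G x \<Phi> $ k $ l * T (axis k 1) (axis l 1) (axis i 1) (axis j 1))) $ c $ d =
    (1/2) * (\<Sum>a\<in>UNIV. \<Sum>b\<in>UNIV. form_comp \<Phi> $ a $ b * T (e a) (e b) (e c) (e d))"
proof -
  have "form_comp (\<chi> i j. (1/2) * (\<Sum>k\<in>UNIV. \<Sum>l\<in>UNIV.
      raise2 G x \<Phi> $ k $ l * T (axis k 1) (axis l 1) (axis i 1) (axis j 1))) $ c $ d =
    (\<Sum>i\<in>UNIV. \<Sum>j\<in>UNIV. \<Sum>a\<in>UNIV. \<Sum>b\<in>UNIV. (1/2) * (form_comp \<Phi> $ a $ b *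
       (e c $ i * e d $ j * T (e a) (e b) (axis i 1) (axis j 1))))"
    unfolding form_comp_nth vec_lambda_beta contraction_frame[OF assms(1,2)]
    by (simp add: sum_distrib_left mult_ac)
  also have "\<dots> = (\<Sum>a\<in>UNIV. \<Sum>b\<in>UNIV. \<Sum>i\<in>UNIV. \<Sum>j\<in>UNIV. (1/2) * (form_comp \<Phi> $ a $ b *
       (e c $ i * e d $ j * T (e a) (e b) (axis i 1) (axis j 1))))"
    by (rule trans[OF sum.cong[OF refl sum_swap3] sum_swap3])
  also have "\<dots> = (1/2) * (\<Sum>a\<in>UNIV. \<Sum>b\<in>UNIV. form_comp \<Phi> $ a $ b * T (e a) (e b) (e c) (e d))"
    using bilinear_axis_expansion[OF assms(3,4), of _ _ "e c" "e d"] by (simp add: sum_distrib_left)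
  finally show ?thesis .
qed

lemma form_comp_scaleR: "form_comp (c *\<^sub>R \<Phi>) = c *\<^sub>R form_comp \<Phi>"
  by (simp add: vec_eq_iff form_comp_nth sum_distrib_left mult_ac)

lemma form_comp_minus: "form_comp (- \<Phi>) = - form_comp \<Phi>"
  using form_comp_scaleR[of "-1" \<Phi>] by simp

lemma form_comp_transpose: "form_comp (transpose \<Phi>) = transpose (form_comp \<Phi>)"
  by (simp add: form_comp_def matrix_transpose_mul matrix_mul_assoc)

lemma form_comp_0: "form_comp 0 = 0"
  using form_comp_scaleR[of 0 0] by simp

section \<open>The Hodge star and anti-self-dual forms in the frame\<close>

lemma linear_det_vector_4:
  "linear (\<lambda>u. det (vector [u, v, w, z] :: real^4^4))" "linear (\<lambda>v. det (vector [u, v, w, z] :: real^4^4))"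
  "linear (\<lambda>w. det (vector [u, v, w, z] :: real^4^4))" "linear (\<lambda>z. det (vector [u, v, w, z] :: real^4^4))"
  by (rule linearI; simp add: det_4 vector_4 algebra_simps)+

lemma form_comp_hodge:
  "form_comp (hodge G x \<Phi>) $ c $ d =
    (1/2) * (\<Sum>a\<in>UNIV. \<Sum>b\<in>UNIV. form_comp \<Phi> $ a $ b * det (vector [axis a 1, axis b 1, axis c 1, axis d 1] :: real^4^4))"
proof -
  have "linear (\<lambda>u. vol G x u v w z)" "linear (\<lambda>v. vol G x u v w z)"
    "linear (\<lambda>w. vol G x u v w z)" "linear (\<lambda>z. vol G x u v w z)" for u v w z
    by (rule linearI; simp add: vol_def linear_add[OF linear_det_vector_4(1)] linear_add[OF linear_det_vector_4(2)]
      linear_add[OF linear_det_vector_4(3)] linear_add[OF linear_det_vector_4(4)]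
      linear_cmul[OF linear_det_vector_4(1)] linear_cmul[OF linear_det_vector_4(2)]
      linear_cmul[OF linear_det_vector_4(3)] linear_cmul[OF linear_det_vector_4(4)] distrib_left)+
  from form_comp_contraction[where T = "vol G x", OF this] show ?thesis
    by (simp add: hodge_def vol_frame)
qed

lemma form_comp_hodge_1:
  "form_comp (hodge G x \<Phi>) $ 1 $ 2 = (form_comp \<Phi> $ 3 $ 4 - form_comp \<Phi> $ 4 $ 3) / 2"
  "form_comp (hodge G x \<Phi>) $ 1 $ 3 = (form_comp \<Phi> $ 4 $ 2 - form_comp \<Phi> $ 2 $ 4) / 2"
  "form_comp (hodge G x \<Phi>) $ 1 $ 4 = (form_comp \<Phi> $ 2 $ 3 - form_comp \<Phi> $ 3 $ 2) / 2"
  unfolding form_comp_hodge sum_4 by (simp_all add: det_4 vector_4 axis_def)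

lemma asd_forms_iff: "\<Phi> \<in> asd_forms G x \<longleftrightarrow> (\<exists>y. form_comp \<Phi> = asd_matrix y)"
proof
  assume "\<Phi> \<in> asd_forms G x"
  then have skew: "transpose \<Phi> = - \<Phi>" and asd: "hodge G x \<Phi> = - \<Phi>"
    by (auto simp: asd_forms_def two_forms_def)
  have t: "transpose (form_comp \<Phi>) = - form_comp \<Phi>"
    using form_comp_transpose[of \<Phi>] form_comp_minus[of \<Phi>] unfolding skew by simp
  have F: "form_comp \<Phi> $ a $ b = - form_comp \<Phi> $ b $ a" for a b
    using arg_cong[OF t, of "\<lambda>A. A $ b $ a"] by (simp add: transpose_def)
  have D: "form_comp \<Phi> $ a $ a = 0" for a using F[of a a] by simp
  have H: "form_comp (hodge G x \<Phi>) $ c $ d = - form_comp \<Phi> $ c $ d" for c d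
    by (simp add: asd form_comp_minus)
  have "form_comp \<Phi> $ 3 $ 4 = - form_comp \<Phi> $ 1 $ 2" "form_comp \<Phi> $ 2 $ 4 = form_comp \<Phi> $ 1 $ 3"
    "form_comp \<Phi> $ 2 $ 3 = - form_comp \<Phi> $ 1 $ 4"
    using H[of 1 2] H[of 1 3] H[of 1 4] F[of 4 3] F[of 4 2] F[of 3 2] unfolding form_comp_hodge_1 by simp_all
  then have "form_comp \<Phi> = asd_matrix (vector [form_comp \<Phi> $ 1 $ 2, form_comp \<Phi> $ 1 $ 3, form_comp \<Phi> $ 1 $ 4])"
    using F[of 2 1] F[of 3 1] F[of 4 1] F[of 3 2] F[of 4 2] F[of 4 3]
    by (simp add: vec_eq_iff forall_4 asd_matrix_nth D)
  then show "\<exists>y. form_comp \<Phi> = asd_matrix y" ..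
next
  assume "\<exists>y. form_comp \<Phi> = asd_matrix y"
  then obtain y where y: "form_comp \<Phi> = asd_matrix y" ..
  have "form_comp (transpose \<Phi>) = form_comp (- \<Phi>)"
    by (simp only: form_comp_transpose form_comp_minus y transpose_asd_matrix)
  moreover have "form_comp (hodge G x \<Phi>) = form_comp (- \<Phi>)"
    by (simp add: vec_eq_iff form_comp_hodge form_comp_minus y)
       (simp add: forall_4 sum_4 asd_matrix_nth det_4 vector_4 axis_def)
  ultimately show "\<Phi> \<in> asd_forms G x"
    by (simp add: asd_forms_def two_forms_def form_comp_inject)
qed

end

section \<open>Curvature of a Kaehler-Einstein metric at a point\<close>

locale einstein_frame = unitary_frame +
  fixes \<kappa> :: real
  assumes einstein: "\<And>u v. ricci G x u v = \<kappa> * ip G x u v"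
begin

lemma scalar_curv_eq: "scalar_curv G x = 4 * \<kappa>"
proof -
  have "(\<Sum>j\<in>UNIV. matrix_inv (G x) $ i $ j * G x $ j $ i) = 1" for i
    using arg_cong[OF matrix_inv_G[OF x], of "\<lambda>A. A $ i $ i"] by (simp add: matrix_matrix_mult_def mat_def)
  then have "(\<Sum>j\<in>UNIV. matrix_inv (G x) $ i $ j * (\<kappa> * G x $ i $ j)) = \<kappa>" for i
    using G_nth_commute[OF x, of i] by (simp add: sum_distrib_left[symmetric] mult.left_commute[of _ \<kappa>])
  then show ?thesis by (simp add: scalar_curv_def einstein ip_axis)
qed

text \<open>The trace over coordinate vectors in \<open>ricci\<close> equals the trace over the
  orthonormal frame.\<close>

lemma ricci_frame: "(\<Sum>a\<in>UNIV. riem G x (e a) v w (e a)) = \<kappa> * ip G x v w"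
proof -
  have "ricci G x v w = (\<Sum>l\<in>UNIV. \<Sum>a\<in>UNIV. e a $ l * riem G x (axis l 1) v w (e a))"
    unfolding ricci_def
  proof (rule sum.cong[OF refl])
    fix l
    show "curv G x (axis l 1) v w $ l = (\<Sum>a\<in>UNIV. e a $ l * riem G x (axis l 1) v w (e a))"
      using arg_cong[OF frame_expansion[of "curv G x (axis l 1) v w"], of "\<lambda>v. v $ l"]
      by (simp add: sum_component riem_def ip_commute[OF x, of "e _"] mult.commute)
  qed
  also have "\<dots> = (\<Sum>a\<in>UNIV. riem G x (e a) v w (e a))"
  proof -
    have "riem G x (e a) v w (e a) = (\<Sum>l\<in>UNIV. e a $ l * riem G x (axis l 1) v w (e a))" for a
      using linear_axis_expansion[OF linear_riem1[of x v w "e a"], of "e a"] by simp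
    then show ?thesis by (subst sum.swap) simp
  qed
  finally show ?thesis by (simp add: einstein)
qed

section \<open>Frame components of the curvature tensor\<close>

definition R :: "4 \<Rightarrow> 4 \<Rightarrow> 4 \<Rightarrow> 4 \<Rightarrow> real" where
  "R a b c d = riem G x (e a) (e b) (e c) (e d)"

lemma R_swap12: "R a b c d = - R b a c d"
  unfolding R_def by (rule riem_antisym12[OF x])

lemma R_swap34: "R a b c d = - R a b d c"
  unfolding R_def by (rule riem_antisym34[OF x])

lemma R_pair: "R a b c d = R c d a b"
  unfolding R_def by (rule riem_pair_symmetric[OF x])

lemma R_diag: "R a a c d = 0" "R a b c c = 0"
  using R_swap12[of a a c d] R_swap34[of a b c c] by simp_all

text \<open>With \<open>R_23\<close>, this says that curvature annihilates
  \<open>e\<^sub>1\<^sub>3 - e\<^sub>2\<^sub>4\<close> and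
  \<open>e\<^sub>1\<^sub>4 + e\<^sub>2\<^sub>3\<close>, the self-dual forms orthogonal to
  \<omega>.\<close>

lemma R_24: "R a b 2 4 = R a b 1 3"
  using riem_J0[OF x, of "e a" "e b" "e 1" "e 3"] by (simp add: R_def J0_e1 J0_e3)

lemma R_23: "R a b 2 3 = - R a b 1 4"
  using riem_J0[OF x, of "e a" "e b" "e 1" "e 4"] by (simp add: R_def J0_e1 J0_e4 linear_riem_rules)

lemma R_24': "R 2 4 c d = R 1 3 c d" and R_23': "R 2 3 c d = - R 1 4 c d"
  using R_24[of c d] R_23[of c d] R_pair by metis+

text \<open>Brings every index pair to one of 12, 13, 14 and 34, up to sign.\<close>

lemmas R_order =
  R_swap12[of 2 1] R_swap12[of 3 1] R_swap12[of 4 1] R_swap12[of 3 2] R_swap12[of 4 2] R_swap12[of 4 3]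
  R_swap34[of _ _ 2 1] R_swap34[of _ _ 3 1] R_swap34[of _ _ 4 1]
  R_swap34[of _ _ 3 2] R_swap34[of _ _ 4 2] R_swap34[of _ _ 4 3]
  R_diag R_24 R_23 R_24' R_23'

text \<open>The Kaehler symmetries, the Bianchi identity and the Einstein equation leave five free curvature
  components besides \<open>\<kappa>\<close>, namely those of the trace-free symmetric matrix of \<open>W\<^sup>-\<close>.\<close>

definition "ka = R 1 3 3 1"
definition "kb = R 1 3 4 1"
definition "kd = R 1 4 4 1"
definition "kp = R 1 2 3 1"
definition "kq = R 1 2 4 1"

lemma ricci_R: "(\<Sum>a\<in>UNIV. R a b c a) = (if b = c then \<kappa> else 0)"
  using ricci_frame[of "e b" "e c"] by (simp add: R_def orthonormal)

lemma R_table: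
  "R 1 3 1 3 = - ka" "R 1 3 1 4 = - kb" "R 1 4 1 3 = - kb" "R 1 4 1 4 = - kd"
  "R 1 2 1 3 = - kp" "R 1 3 1 2 = - kp" "R 1 2 1 4 = - kq" "R 1 4 1 2 = - kq"
  "R 1 2 3 4 = - (ka + kd)" "R 3 4 1 2 = - (ka + kd)"
  "R 1 2 1 2 = ka + kd - \<kappa>" "R 3 4 3 4 = ka + kd - \<kappa>"
  "R 1 3 3 4 = kp" "R 3 4 1 3 = kp" "R 1 4 3 4 = kq" "R 3 4 1 4 = kq"
proof -
  show 1: "R 1 3 1 3 = - ka" "R 1 3 1 4 = - kb" "R 1 4 1 4 = - kd" "R 1 2 1 3 = - kp" "R 1 2 1 4 = - kq"
    unfolding ka_def kb_def kd_def kp_def kq_def by (rule R_swap34)+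
  show 2: "R 1 4 1 3 = - kb" "R 1 3 1 2 = - kp" "R 1 4 1 2 = - kq"
    using 1 R_pair[of 1 4 1 3] R_pair[of 1 3 1 2] R_pair[of 1 4 1 2] by simp_all
  have "R 1 2 3 4 + R 2 3 1 4 + R 3 1 2 4 = 0"
    unfolding R_def by (rule riem_bianchi[OF x])
  then show 3: "R 1 2 3 4 = - (ka + kd)"
    using R_23'[of 1 4] R_swap12[of 3 1 2 4] R_24[of 1 3] 1 by simp
  then show "R 3 4 1 2 = - (ka + kd)" using R_pair[of 3 4 1 2] by simp
  show "R 1 2 1 2 = ka + kd - \<kappa>" "R 3 4 3 4 = ka + kd - \<kappa>"
    using ricci_R[of 1 1] ricci_R[of 3 3] 1 by (simp_all add: sum_4 R_order)
  \<comment> \<open>The off-diagonal Ricci equations say that \<omega> is orthogonal to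
    \<open>e\<^sub>1\<^sub>3 + e\<^sub>2\<^sub>4\<close> and
    \<open>e\<^sub>1\<^sub>4 - e\<^sub>2\<^sub>3\<close> for the curvature operator.\<close>
  show 4: "R 1 3 3 4 = kp" "R 1 4 3 4 = kq"
    using ricci_R[of 1 3] ricci_R[of 1 4] 1 by (simp_all add: sum_4 R_order)
  show "R 3 4 1 3 = kp" "R 3 4 1 4 = kq"
    using 4 R_pair[of 3 4 1 3] R_pair[of 3 4 1 4] by simp_all
qed

text \<open>The matrix of \<open>W\<^sup>-\<close> in the coordinates of \<^const>\<open>asd_matrix\<close>.\<close>

definition B :: "real^3^3" where
  "B = vector [vector [2 * \<kappa> / 3 - 2 * ka - 2 * kd, 2 * kp, 2 * kq],
    vector [2 * kp, 2 * ka - \<kappa> / 3, 2 * kb], vector [2 * kq, 2 * kb, 2 * kd - \<kappa> / 3]]"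

lemma transpose_B: "transpose B = B"
  by (simp add: vec_eq_iff forall_3 transpose_def B_def)

text \<open>With Ricci equal to \<kappa> g and s = 4 \<kappa>, the two correction terms add up to
  -\<kappa>/6 times the product of g with itself, which carries a factor 2. On two-forms this
  subtracts \<kappa>/3 = s/12.\<close>

lemma weyl_eq: "weyl G x u v w z = riem G x u v w z - \<kappa> / 3 * (ip G x v w * ip G x u z - ip G x u w * ip G x v z)"
  by (simp add: weyl_def kn_prod_def scalar_curv_eq einstein algebra_simps)

lemma weyl_operator_asd:
  assumes "form_comp \<Phi> = asd_matrix y"
  shows "form_comp (weyl_operator G x \<Phi>) = asd_matrix (B *v y)"
proof -
  \<comment> \<open>The last two arguments are exchanged because \<open>form_operator\<close> takes
    them in reversed order.\<close>
  have lin: "linear (\<lambda>u. weyl G x u v z w)" "linear (\<lambda>v. weyl G x u v z w)"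
    "linear (\<lambda>w. weyl G x u v z w)" "linear (\<lambda>z. weyl G x u v z w)" for u v w z
    by (rule linearI; simp add: weyl_eq linear_riem_rules linear_ip_rules algebra_simps add_divide_distrib diff_divide_distrib)+
  have W: "weyl G x (e a) (e b) (e d) (e c) = R a b d c - \<kappa> / 3 *
      ((if b = d then 1 else 0) * (if a = c then 1 else 0) - (if a = d then 1 else 0) * (if b = c then 1 else 0))" for a b c d
    by (simp only: weyl_eq R_def orthonormal)
  have C: "form_comp (weyl_operator G x \<Phi>) $ c $ d = (1/2) * (\<Sum>a\<in>UNIV. \<Sum>b\<in>UNIV. asd_matrix y $ a $ b *
      weyl G x (e a) (e b) (e d) (e c))" for c d
    unfolding weyl_operator_def form_operator_def
    using form_comp_contraction[where T = "\<lambda>u v w z. weyl G x u v z w" and \<Phi> = \<Phi> and c = c and d = d, OF lin] assms by simp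
  show ?thesis
    by (simp add: vec_eq_iff forall_4 C W sum_4 asd_matrix_nth R_order R_table B_def matrix_vector_mult_def sum_3)
       (simp add: field_simps)
qed

text \<open>Frame components identify the anti-self-dual forms with \<open>real^3\<close> and
  conjugate W^- to \<open>B\<close>.\<close>

lemma weyl_minus_eigenvalue_iff:
  "(\<exists>\<Phi>\<in>asd_forms G x. \<Phi> \<noteq> 0 \<and> weyl_operator G x \<Phi> = \<mu> *\<^sub>R \<Phi>) \<longleftrightarrow> (\<exists>y. y \<noteq> 0 \<and> B *v y = \<mu> *\<^sub>R y)"
proof
  assume "\<exists>\<Phi>\<in>asd_forms G x. \<Phi> \<noteq> 0 \<and> weyl_operator G x \<Phi> = \<mu> *\<^sub>R \<Phi>"
  then obtain \<Phi> y where "\<Phi> \<noteq> 0" "weyl_operator G x \<Phi> = \<mu> *\<^sub>R \<Phi>" and y: "form_comp \<Phi> = asd_matrix y"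
    using asd_forms_iff by blast
  then have "asd_matrix (B *v y) = asd_matrix (\<mu> *\<^sub>R y)"
    using weyl_operator_asd[OF y] by (simp add: form_comp_scaleR asd_matrix_scaleR)
  moreover have "y \<noteq> 0"
    using \<open>\<Phi> \<noteq> 0\<close> y form_comp_inject[of \<Phi> 0] asd_matrix_eq_0[of y] form_comp_0 by auto
  ultimately show "\<exists>y. y \<noteq> 0 \<and> B *v y = \<mu> *\<^sub>R y" by (auto simp: asd_matrix_inject)
next
  assume "\<exists>y. y \<noteq> 0 \<and> B *v y = \<mu> *\<^sub>R y"
  then obtain y where y: "y \<noteq> 0" "B *v y = \<mu> *\<^sub>R y" by blast
  obtain \<Phi> where \<Phi>: "form_comp \<Phi> = asd_matrix y" using form_comp_inverse by blast
  have "form_comp (weyl_operator G x \<Phi>) = form_comp (\<mu> *\<^sub>R \<Phi>)"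
    using weyl_operator_asd[OF \<Phi>] by (simp add: form_comp_scaleR asd_matrix_scaleR \<Phi> y)
  moreover have "\<Phi> \<noteq> 0" using \<Phi> y asd_matrix_eq_0 form_comp_0 by metis
  ultimately show "\<exists>\<Phi>\<in>asd_forms G x. \<Phi> \<noteq> 0 \<and> weyl_operator G x \<Phi> = \<mu> *\<^sub>R \<Phi>"
    using \<Phi> asd_forms_iff form_comp_inject by blast
qed

section \<open>Holomorphic sectional curvature as a quadratic form on the sphere\<close>

lemma riem_holomorphic_plane:
  fixes x1 x2 x3 x4 :: real
  defines "X \<equiv> x1 *\<^sub>R e 1 + x2 *\<^sub>R e 2 + x3 *\<^sub>R e 3 + x4 *\<^sub>R e 4"
  assumes unit: "x1\<^sup>2 + x2\<^sup>2 + x3\<^sup>2 + x4\<^sup>2 = 1"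
    and y: "y $ 1 = x1\<^sup>2 + x2\<^sup>2 - x3\<^sup>2 - x4\<^sup>2" "y $ 2 = 2 * (x2 * x3 - x1 * x4)" "y $ 3 = 2 * (x1 * x3 + x2 * x4)"
  shows "riem G x X (J0 X) (J0 X) X = 2 * \<kappa> / 3 + y \<bullet> (B *v y) / 2"
proof -
  have JX: "J0 X = (- x2) *\<^sub>R e 1 + x1 *\<^sub>R e 2 + (- x4) *\<^sub>R e 3 + x3 *\<^sub>R e 4"
    by (simp add: X_def linear_J0_rules J0_e1 J0_e2 J0_e3 J0_e4)
  \<comment> \<open>Pluecker coordinates: \<open>X \<and> J X\<close> is \<open>s e\<^sub>1\<^sub>2
    + m e\<^sub>1\<^sub>3 + n e\<^sub>1\<^sub>4 - n e\<^sub>2\<^sub>3 + m e\<^sub>2\<^sub>4 + t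
    e\<^sub>3\<^sub>4\<close>. Twice its anti-self-dual part has the \<open>asd_matrix\<close>
    coordinates (s - t, 2m, 2n), which is y.\<close>
  define s t m n where "s = x1\<^sup>2 + x2\<^sup>2" and "t = x3\<^sup>2 + x4\<^sup>2" and "m = x2 * x3 - x1 * x4" and "n = x1 * x3 + x2 * x4"
  have 1: "riem G x X (J0 X) w z = s * riem G x (e 1) (e 2) w z + m * riem G x (e 1) (e 3) w z + n * riem G x (e 1) (e 4) w z
      - n * riem G x (e 2) (e 3) w z + m * riem G x (e 2) (e 4) w z + t * riem G x (e 3) (e 4) w z" for w z
    unfolding JX unfolding X_def
    by (subst alternating_combination[where T = "\<lambda>u v. riem G x u v w z", OF linear_riem1 linear_riem2 riem_antisym12[OF x]])
      (simp add: s_def t_def m_def n_def power2_eq_square algebra_simps)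
  have 2: "riem G x u v (J0 X) X = - (s * riem G x u v (e 1) (e 2) + m * riem G x u v (e 1) (e 3) + n * riem G x u v (e 1) (e 4)
      - n * riem G x u v (e 2) (e 3) + m * riem G x u v (e 2) (e 4) + t * riem G x u v (e 3) (e 4))" for u v
    unfolding JX unfolding X_def
    by (subst alternating_combination[where T = "\<lambda>w z. riem G x u v w z", OF linear_riem3 linear_riem4 riem_antisym34[OF x]])
      (simp add: s_def t_def m_def n_def power2_eq_square algebra_simps)
  have r: "riem G x X (J0 X) (J0 X) X = (\<kappa> - ka - kd) * (s\<^sup>2 + t\<^sup>2) + 2 * (ka + kd) * (s * t)
     + 4 * ka * m\<^sup>2 + 4 * kd * n\<^sup>2 + 8 * kb * (m * n) + 4 * kp * ((s - t) * m) + 4 * kq * ((s - t) * n)"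
    unfolding 1 unfolding 2
    by (simp add: R_def[symmetric] R_order R_table power2_eq_square algebra_simps)
  have yB: "y \<bullet> (B *v y) = (2 * \<kappa> / 3 - 2 * ka - 2 * kd) * (s - t)\<^sup>2 + 8 * ka * m\<^sup>2 + 8 * kd * n\<^sup>2 - 4 / 3 * \<kappa> * (m\<^sup>2 + n\<^sup>2)
     + 16 * kb * (m * n) + 8 * kp * ((s - t) * m) + 8 * kq * ((s - t) * n)"
  proof -
    have "y $ 1 = s - t" "y $ 2 = 2 * m" "y $ 3 = 2 * n"
      by (simp_all add: y s_def t_def m_def n_def)
    then show ?thesis
      by (simp add: inner_vec_def matrix_vector_mult_def sum_3 B_def power2_eq_square) (simp add: field_simps)
  qed
  \<comment> \<open>The bivector \<open>X \<and> J X\<close> is decomposable.\<close>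
  have st: "m\<^sup>2 + n\<^sup>2 = s * t"
    by (simp add: s_def t_def m_def n_def power2_eq_square algebra_simps)
  \<comment> \<open>After inserting \<open>st\<close>, the two sides of the goal differ by
    2\<kappa>/3 times (s + t)^2 - 1.\<close>
  have s: "s = 1 - t" using unit by (simp add: s_def t_def)
  show ?thesis
    unfolding r yB st unfolding s by (simp add: power2_eq_square field_simps)
qed

lemma ip_frame_combination:
  "ip G x (x1 *\<^sub>R e 1 + x2 *\<^sub>R e 2 + x3 *\<^sub>R e 3 + x4 *\<^sub>R e 4)
    (x1 *\<^sub>R e 1 + x2 *\<^sub>R e 2 + x3 *\<^sub>R e 3 + x4 *\<^sub>R e 4) = x1\<^sup>2 + x2\<^sup>2 + x3\<^sup>2 + x4\<^sup>2"
  by (simp add: linear_ip_rules orthonormal power2_eq_square)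

lemma hol_sectional_unit:
  assumes "ip G x X X = 1"
  shows "hol_sectional G x X = riem G x X (J0 X) (J0 X) X"
proof -
  have "ip G x X (J0 X) = 0"
    using ip_J0_left[OF x, of X X] ip_commute[OF x, of X "J0 X"] by simp
  then show ?thesis
    using assms by (simp add: hol_sectional_def sectional_def hermitian[OF x])
qed

lemma hol_sectional_values_eq: "hol_sectional_values G x = {2 * \<kappa> / 3 + y \<bullet> (B *v y) / 2 | y. norm y = 1}"
proof (intro equalityI subsetI)
  fix h
  assume "h \<in> hol_sectional_values G x"
  then obtain X where X: "ip G x X X = 1" and h: "h = hol_sectional G x X"
    by (auto simp: hol_sectional_values_def)
  obtain x1 x2 x3 x4 where X_eq: "X = x1 *\<^sub>R e 1 + x2 *\<^sub>R e 2 + x3 *\<^sub>R e 3 + x4 *\<^sub>R e 4"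
    using frame_expansion[of X] unfolding sum_4 by blast
  have unit: "x1\<^sup>2 + x2\<^sup>2 + x3\<^sup>2 + x4\<^sup>2 = 1"
    using X unfolding X_eq ip_frame_combination .
  define y :: "real^3" where
    "y = vector [x1\<^sup>2 + x2\<^sup>2 - x3\<^sup>2 - x4\<^sup>2, 2 * (x2 * x3 - x1 * x4), 2 * (x1 * x3 + x2 * x4)]"
  have y: "y $ 1 = x1\<^sup>2 + x2\<^sup>2 - x3\<^sup>2 - x4\<^sup>2" "y $ 2 = 2 * (x2 * x3 - x1 * x4)" "y $ 3 = 2 * (x1 * x3 + x2 * x4)"
    by (simp_all add: y_def)
  \<comment> \<open>The Hopf map squares the norm, so unit vectors go to unit vectors.\<close>
  have "y \<bullet> y = (x1\<^sup>2 + x2\<^sup>2 + x3\<^sup>2 + x4\<^sup>2)\<^sup>2"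
    by (simp add: inner_vec_def sum_3 y power2_eq_square algebra_simps)
  then have "norm y = 1" by (simp add: unit norm_eq_1)
  moreover have "h = 2 * \<kappa> / 3 + y \<bullet> (B *v y) / 2"
    using riem_holomorphic_plane[OF unit y] unfolding h hol_sectional_unit[OF X] unfolding X_eq .
  ultimately show "h \<in> {2 * \<kappa> / 3 + y \<bullet> (B *v y) / 2 | y. norm y = 1}" by blast
next
  fix h
  assume "h \<in> {2 * \<kappa> / 3 + y \<bullet> (B *v y) / 2 | y. norm y = 1}"
  then obtain y where h: "h = 2 * \<kappa> / 3 + y \<bullet> (B *v y) / 2" and "norm y = 1" by blast
  then have "(y $ 1)\<^sup>2 + (y $ 2)\<^sup>2 + (y $ 3)\<^sup>2 = 1"
    by (simp add: norm_eq_1 inner_vec_def sum_3 power2_eq_square)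
  then obtain x1 x2 x3 x4 where unit: "x1\<^sup>2 + x2\<^sup>2 + x3\<^sup>2 + x4\<^sup>2 = 1"
    and y: "y $ 1 = x1\<^sup>2 + x2\<^sup>2 - x3\<^sup>2 - x4\<^sup>2" "y $ 2 = 2 * (x2 * x3 - x1 * x4)" "y $ 3 = 2 * (x1 * x3 + x2 * x4)"
    by (rule hopf_surjective)
  have X: "ip G x (x1 *\<^sub>R e 1 + x2 *\<^sub>R e 2 + x3 *\<^sub>R e 3 + x4 *\<^sub>R e 4)
    (x1 *\<^sub>R e 1 + x2 *\<^sub>R e 2 + x3 *\<^sub>R e 3 + x4 *\<^sub>R e 4) = 1"
    using unit by (simp only: ip_frame_combination)
  show "h \<in> hol_sectional_values G x"
    using X hol_sectional_unit[OF X] riem_holomorphic_plane[OF unit y]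
    unfolding hol_sectional_values_def h by force
qed

lemma hol_sectional_extrema:
  assumes es: "weyl_minus_eigenvalues G x [lam1, lam2, lam3]" and "lam1 \<le> lam2" "lam2 \<le> lam3"
  shows "is_maximum (hol_sectional_values G x) (scalar_curv G x / 6 + lam3 / 2)
       \<and> is_minimum (hol_sectional_values G x) (scalar_curv G x / 6 + lam1 / 2)"
proof -
  \<comment> \<open>A value occurs in the list exactly when its eigenspace has nonzero dimension, so
    multiplicities reduce to mere occurrence.\<close>
  have eig: "\<mu> \<in> {lam1, lam2, lam3} \<longleftrightarrow> (\<exists>y. y \<noteq> 0 \<and> B *v y = \<mu> *\<^sub>R y)" for \<mu>
  proof -
    have "\<mu> \<in> set [lam1, lam2, lam3] \<longleftrightarrow> count_list [lam1, lam2, lam3] \<mu> \<noteq> 0"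
      by (simp only: count_list_0_iff not_not)
    also have "\<dots> \<longleftrightarrow> dim {\<Phi> \<in> asd_forms G x. weyl_operator G x \<Phi> = \<mu> *\<^sub>R \<Phi>} \<noteq> 0"
      using es by (simp only: weyl_minus_eigenvalues_def eigenvalues_on_def)
    also have "\<dots> \<longleftrightarrow> (\<exists>\<Phi>\<in>asd_forms G x. \<Phi> \<noteq> 0 \<and> weyl_operator G x \<Phi> = \<mu> *\<^sub>R \<Phi>)"
      by (auto simp: dim_eq_0)
    finally show ?thesis by (simp add: weyl_minus_eigenvalue_iff)
  qed
  have bounds: "lam1 \<le> \<mu>" "\<mu> \<le> lam3" if "y \<noteq> 0" "B *v y = \<mu> *\<^sub>R y" for \<mu> y
    using eig[of \<mu>] that assms(2,3) by auto
  have max: "(\<exists>y. norm y = 1 \<and> y \<bullet> (B *v y) = lam3) \<and> (\<forall>y. norm y = 1 \<longrightarrow> y \<bullet> (B *v y) \<le> lam3)"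
    by (rule symmetric_matrix_max_eq_largest_eigenvalue[OF transpose_B]) (use eig[of lam3] bounds in auto)
  have min: "(\<exists>y. norm y = 1 \<and> y \<bullet> (B *v y) = lam1) \<and> (\<forall>y. norm y = 1 \<longrightarrow> lam1 \<le> y \<bullet> (B *v y))"
    by (rule symmetric_matrix_min_eq_smallest_eigenvalue[OF transpose_B]) (use eig[of lam1] bounds in auto)
  have s: "scalar_curv G x / 6 = 2 * \<kappa> / 3" by (simp add: scalar_curv_eq)
  show ?thesis
    unfolding is_maximum_def is_minimum_def hol_sectional_values_eq s using max min by force
qed

end

theorem corollary2:
  fixes M :: "'m topology"
    and A :: "'m chart set"
    and g :: "'m chart \<Rightarrow> real^4 \<Rightarrow> real^4^4"
    and c :: "'m chart" and p :: 'm
    and lam1 lam2 lam3 :: real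
  assumes "kaehler_einstein_surface M A g"
    and "c \<in> A" and "p \<in> fst c"
    and "weyl_minus_eigenvalues (g c) (snd c p) [lam1, lam2, lam3]"
    and "lam1 \<le> lam2" and "lam2 \<le> lam3"
  shows "is_maximum (hol_sectional_values (g c) (snd c p))
           (scalar_curv (g c) (snd c p) / 6 + lam3 / 2)
       \<and> is_minimum (hol_sectional_values (g c) (snd c p))
           (scalar_curv (g c) (snd c p) / 6 + lam1 / 2)"
proof -
  \<comment> \<open>The claim is pointwise, so a single holomorphic chart around p suffices.\<close>
  define U where "U = snd c ` fst c"
  have x: "snd c p \<in> U" using assms(3) by (simp add: U_def)
  have K: "complex_surface M A" "hermitian_metric A g" "closed_2form_on U (kaehler_form (g c))" "einstein_metric A g"
    using assms(1,2) by (auto simp: kaehler_einstein_surface_def kaehler_surface_def U_def)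
  have "is_chart M c" using K(1) assms(2) by (auto simp: complex_surface_def)
  then have U: "open U" by (simp add: is_chart_def U_def)
  have smooth: "smooth_on U (\<lambda>x. g c x $ i $ j)" for i j
    using K(2) assms(2) by (simp add: hermitian_metric_def riemannian_metric_def U_def)
  have metric: "transpose (g c y) = g c y" "v \<noteq> 0 \<Longrightarrow> ip (g c) y v v > 0" if "y \<in> U" for y v
    using K(2) assms(2) that unfolding hermitian_metric_def riemannian_metric_def U_def by blast+
  have hermitian: "ip (g c) y (J0 u) (J0 v) = ip (g c) y u v" if "y \<in> U" for y u v
    using K(2) assms(2) that unfolding hermitian_metric_def U_def by blast
  interpret kaehler_chart "g c" U
  proof unfold_locales
    show "open U" by (rule U)
    show "smooth_on U (\<lambda>x. g c x $ i $ j)" for i j by (rule smooth)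
    show "transpose (g c y) = g c y" if "y \<in> U" for y using that by (rule metric(1))
    show "ip (g c) y v v > 0" if "y \<in> U" "v \<noteq> 0" for y v using that by (rule metric(2))
    show "ip (g c) y (J0 u) (J0 v) = ip (g c) y u v" if "y \<in> U" for y u v using that by (rule hermitian)
    show "closed_2form_on U (kaehler_form (g c))" by (rule K(3))
  qed
  obtain e :: "4 \<Rightarrow> real^4" where e: "\<forall>a b. ip (g c) (snd c p) (e a) (e b) = (if a = b then 1 else 0)"
    "J0 (e 1) = e 2" "J0 (e 3) = e 4"
    using unitary_frame_exists[OF x] by metis
  obtain \<kappa> where \<kappa>: "\<And>u v. ricci (g c) (snd c p) u v = \<kappa> * ip (g c) (snd c p) u v"
    using K(4) assms(2) x unfolding einstein_metric_def U_def by blast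
  interpret einstein_frame "g c" U "snd c p" e \<kappa>
    by unfold_locales (simp_all add: x e \<kappa>)
  show ?thesis
    using assms(4-6) by (rule hol_sectional_extrema)
qed

end
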